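(* The tuple $(K[\mathcal{T}[\infty]],\star,\Delta_{\mathrm s})$ is a graded Hopf algebra; in particular $\star$ is associative and $\Delta_{\mathrm s}(t\star w)=\Delta_{\mathrm s}(t)\star\Delta_{\mathrm s}(w)$ for all $t,w\in\mathcal{T}[\infty]$.
   Context: $K$ is a field. A tree is a finite planar rooted tree, degree = number of non-root nodes, $\odot$ the one-node tree. An $n$--tree is a tree of degree $n$ whose non-root nodes are labelled bijectively by $\{1,\dots,n\}$; $\mathcal{T}[\infty]$ is the set of all $n$--trees, $K[\mathcal{T}[\infty]]$ the vector space with basis $\mathcal{T}[\infty]$. Nodes $N(t)$ are ordered by depth-first post-order (subtrees left to right recursively, then the node; root maximal); write $u_1<\dots<u_n$ for non-root nodes. For a set $A$ of non-root nodes, $t_A$ is obtained by deleting non-root nodes outside $A$ (children attached in order to the parent in place of the deleted node), labels kept; $t_{[i,j]}=t_{\{u_h,\dots,u_k\}}$ if $i\le j$ and $[i,j]\cap[n]=[h,k]\ne\emptyset$, else $\odot$. Standardization $\mathrm s(t)$ of an $\mathbb N$-labelled tree with distinct labels relabels by $1,\dots,|t|$ preserving relative order. $\Delta_{\mathrm s}(t)=\sum_{k=0}^n\mathrm s(t_{[1,k]})\otimes\mathrm s(t_{[k+1,n]})$. The $m$--shift $w[m]$ adds $m$ to every label. For labelled trees: a partition of $u$ of degree $n\ge1$ is an ordered tuple $(u_{[n_0+1,n_1]},\dots,u_{[n_{k-1}+1,n_k]})$, $0=n_0<\dots<n_k=n$; for $P=(u_1,\dots,u_k)$, $I(P,t)$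 is the set of maps $f$ from blocks to $N(t)$ with $f(u_1)<\dots<f(u_k)$; $t\#_{P,f}u$ identifies the root of each $u_i$ with $f(u_i)$, the root-children of $u_i$ becoming children of $f(u_i)$ to the right of its original children, all labels kept; $t* u=\sum_{P,f}t\#_{P,f}u$ ($|u|\ge1$), $t*\odot=t$. The star product is $t\star w=t* w[m]$ for $|t|=m$, extended bilinearly. *)

theory Defs
  imports Main "HOL-Library.Poly_Mapping"
begin

text \<open>A non-root node carries a label and the ordered list of its children.
  A planar rooted tree is represented by the ordered list (forest) of the
  children of its (unlabelled) root; the one-node tree is the empty list.\<close>

datatype ltree = LN nat "ltree list"

type_synonym rtree = "ltree list"

text \<open>Labels of the non-root nodes in depth-first post-order
  (subtrees left to right, then the node); the root comes last (maximal).\<close>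

fun post :: "ltree \<Rightarrow> nat list" where
  "post (LN a cs) = concat (map post cs) @ [a]"

definition postF :: "rtree \<Rightarrow> nat list" where
  "postF ts = concat (map post ts)"

definition deg :: "rtree \<Rightarrow> nat" where
  "deg ts = length (postF ts)"

definition is_ntree :: "rtree \<Rightarrow> bool" where
  "is_ntree ts \<longleftrightarrow> distinct (postF ts) \<and> set (postF ts) = {1..deg ts}"

text \<open>Restriction t_A to the non-root nodes whose labels lie in A (labels are distinct,
  so nodes are identified by labels); children of deleted nodes are attached in order
  to the parent in place of the deleted node.\<close>
fun restr :: "nat set \<Rightarrow> ltree \<Rightarrow> ltree list" where
  "restr A (LN a cs) =
     (if a \<in> A then [LN a (concat (map (restr A) cs))] else concat (map (restr A) cs))"

definition restrF :: "nat set \<Rightarrow> rtree \<Rightarrow> rtree" where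
  "restrF A ts = concat (map (restr A) ts)"

text \<open>t_[i+1,j] in terms of post-order positions (0-based): nodes u_(i+1),...,u_j.\<close>
definition interval_tree :: "nat \<Rightarrow> nat \<Rightarrow> rtree \<Rightarrow> rtree" where
  "interval_tree i j ts = restrF (set (drop i (take j (postF ts)))) ts"

fun relabel :: "(nat \<Rightarrow> nat) \<Rightarrow> ltree \<Rightarrow> ltree" where
  "relabel g (LN a cs) = LN (g a) (map (relabel g) cs)"

definition relabelF :: "(nat \<Rightarrow> nat) \<Rightarrow> rtree \<Rightarrow> rtree" where
  "relabelF g ts = map (relabel g) ts"

definition std :: "rtree \<Rightarrow> rtree" where
  "std ts = relabelF (\<lambda>a. card {b \<in> set (postF ts). b \<le> a}) ts"

definition shift :: "nat \<Rightarrow> rtree \<Rightarrow> rtree" where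
  "shift m ts = relabelF (\<lambda>a. a + m) ts"

fun graftL :: "(nat \<Rightarrow> rtree) \<Rightarrow> ltree \<Rightarrow> ltree" where
  "graftL h (LN a cs) = LN a (map (graftL h) cs @ h a)"

text \<open>t #_(P,f) u.  The partition P of u (degree n \<ge> 1) is given by the set S \<subseteq> {1..n-1}
  of inner cut points (0 = n_0 < ... < n_k = n with {n_1..n_(k-1)} = S); block i is
  u_[n_(i-1)+1, n_i].  The strictly increasing map f is given by its image F, a set of
  k nodes of t, nodes being indexed by post-order position 0..m (root = m = |t|).
  The root-children of the i-th block become children of the i-th element of F, to the
  right of its original children.\<close>
definition graft :: "rtree \<Rightarrow> rtree \<Rightarrow> nat set \<Rightarrow> nat set \<Rightarrow> rtree" where
  "graft t u S F =
    (let n = deg u; m = deg t;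
         cuts = sorted_list_of_set ({0, n} \<union> S);
         blocks = map (\<lambda>(i, j). interval_tree i j u) (zip cuts (tl cuts));
         targets = sorted_list_of_set F;
         extra = (\<lambda>p. case map_of (zip targets blocks) p of None \<Rightarrow> [] | Some f \<Rightarrow> f);
         h = (\<lambda>a. case map_of (zip (postF t) [0..<m]) a of None \<Rightarrow> [] | Some p \<Rightarrow> extra p)
     in map (graftL h) t @ extra m)"

typedef ntree = "{ts. is_ntree ts}"
  morphisms tree_of Abs_ntree
  by (rule exI[of _ "[]"]) (simp add: is_ntree_def postF_def deg_def)

definition unit_tree :: ntree where
  "unit_tree = Abs_ntree []"

definition ndeg :: "ntree \<Rightarrow> nat" where
  "ndeg t = deg (tree_of t)"

definition cmul :: "'k::field \<Rightarrow> ('a \<Rightarrow>\<^sub>0 'k) \<Rightarrow> ('a \<Rightarrow>\<^sub>0 'k)" where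
  "cmul c x = Poly_Mapping.map (\<lambda>y. c * y) x"

definition lext :: "('a \<Rightarrow> ('b \<Rightarrow>\<^sub>0 'k::field)) \<Rightarrow> ('a \<Rightarrow>\<^sub>0 'k) \<Rightarrow> ('b \<Rightarrow>\<^sub>0 'k)" where
  "lext f x = (\<Sum>a \<in> Poly_Mapping.keys x. cmul (Poly_Mapping.lookup x a) (f a))"

definition blext :: "('a \<Rightarrow> 'b \<Rightarrow> ('c \<Rightarrow>\<^sub>0 'k::field)) \<Rightarrow> ('a \<Rightarrow>\<^sub>0 'k) \<Rightarrow> ('b \<Rightarrow>\<^sub>0 'k) \<Rightarrow> ('c \<Rightarrow>\<^sub>0 'k)" where
  "blext f x y = lext (\<lambda>a. lext (\<lambda>b. f a b) y) x"

definition basis :: "'a \<Rightarrow> ('a \<Rightarrow>\<^sub>0 'k::field)" where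
  "basis a = Poly_Mapping.single a 1"

text \<open>tensor product x \<otimes> y in K[A] \<otimes> K[B] = K[A \<times> B]\<close>
definition tens :: "('a \<Rightarrow>\<^sub>0 'k::field) \<Rightarrow> ('b \<Rightarrow>\<^sub>0 'k) \<Rightarrow> ('a \<times> 'b \<Rightarrow>\<^sub>0 'k)" where
  "tens x y = blext (\<lambda>a b. basis (a, b)) x y"

text \<open>t * u on basis elements (u is already shifted).\<close>
definition graft_sum :: "rtree \<Rightarrow> rtree \<Rightarrow> (ntree \<Rightarrow>\<^sub>0 'k::field)" where
  "graft_sum t u =
    (if deg u = 0 then basis (Abs_ntree t)
     else (\<Sum>S \<in> Pow {1..<deg u}.
             \<Sum>F \<in> {F. F \<subseteq> {0..deg t} \<and> card F = card S + 1}.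
               basis (Abs_ntree (graft t u S F))))"

definition star_basis :: "ntree \<Rightarrow> ntree \<Rightarrow> (ntree \<Rightarrow>\<^sub>0 'k::field)" where
  "star_basis t w = graft_sum (tree_of t) (shift (ndeg t) (tree_of w))"

definition star :: "(ntree \<Rightarrow>\<^sub>0 'k::field) \<Rightarrow> (ntree \<Rightarrow>\<^sub>0 'k) \<Rightarrow> (ntree \<Rightarrow>\<^sub>0 'k)" where
  "star x y = blext star_basis x y"

definition delta_basis :: "ntree \<Rightarrow> (ntree \<times> ntree \<Rightarrow>\<^sub>0 'k::field)" where
  "delta_basis t =
    (\<Sum>k \<in> {0..ndeg t}.
       basis (Abs_ntree (std (interval_tree 0 k (tree_of t))),
              Abs_ntree (std (interval_tree k (ndeg t) (tree_of t)))))"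

definition delta_s :: "(ntree \<Rightarrow>\<^sub>0 'k::field) \<Rightarrow> (ntree \<times> ntree \<Rightarrow>\<^sub>0 'k)" where
  "delta_s x = lext delta_basis x"

text \<open>Everything is given by structure constants on a basis of type 'b and extended
  (bi)linearly: mb = product, e = unit (a basis element), db = coproduct, eps = counit,
  dg = grading.  The tensor product (a \<otimes> b) * (c \<otimes> d) = (a*c) \<otimes> (b*d).\<close>

definition graded_hopf_basis ::
  "('b \<Rightarrow> 'b \<Rightarrow> ('b \<Rightarrow>\<^sub>0 'k::field)) \<Rightarrow> 'b \<Rightarrow> ('b \<Rightarrow> ('b \<times> 'b \<Rightarrow>\<^sub>0 'k)) \<Rightarrow> ('b \<Rightarrow> 'k)
    \<Rightarrow> ('b \<Rightarrow> nat) \<Rightarrow> bool" where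
  "graded_hopf_basis mb e db eps dg \<longleftrightarrow>
    (let m = blext mb; d = lext db;
         epsl = (\<lambda>x. \<Sum>a \<in> Poly_Mapping.keys x. Poly_Mapping.lookup x a * eps a);
         m2 = blext (\<lambda>(a, b) (a', b'). tens (mb a a') (mb b b'))
     in
      \<comment> \<open>associative unital algebra\<close>
      (\<forall>x y z. m (m x y) z = m x (m y z)) \<and>
      (\<forall>x. m (basis e) x = x \<and> m x (basis e) = x) \<and>
      \<comment> \<open>coassociative counital coalgebra\<close>
      (\<forall>x. lext (\<lambda>(a, b). lext (\<lambda>(c, c'). basis (c, c', b)) (db a)) (d x)
         = lext (\<lambda>(a, b). lext (\<lambda>(c, c'). basis (a, c, c')) (db b)) (d x)) \<and>
      (\<forall>x. lext (\<lambda>(a, b). cmul (eps a) (basis b)) (d x) = x \<and>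
           lext (\<lambda>(a, b). cmul (eps b) (basis a)) (d x) = x) \<and>
      \<comment> \<open>bialgebra: coproduct and counit are algebra morphisms\<close>
      (\<forall>x y. d (m x y) = m2 (d x) (d y)) \<and>
      d (basis e) = basis (e, e) \<and>
      (\<forall>x y. epsl (m x y) = epsl x * epsl y) \<and>
      eps e = 1 \<and>
      \<comment> \<open>grading\<close>
      dg e = 0 \<and>
      (\<forall>a b. \<forall>c \<in> Poly_Mapping.keys (mb a b). dg c = dg a + dg b) \<and>
      (\<forall>a. \<forall>(b, c) \<in> Poly_Mapping.keys (db a). dg b + dg c = dg a) \<and>
      \<comment> \<open>antipode (a linear map given on the basis)\<close>
      (\<exists>s :: 'b \<Rightarrow> ('b \<Rightarrow>\<^sub>0 'k). \<forall>x.
         lext (\<lambda>(a, b). m (s a) (basis b)) (d x) = cmul (epsl x) (basis e) \<and>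
         lext (\<lambda>(a, b). m (basis a) (s b)) (d x) = cmul (epsl x) (basis e)))"

definition counit_basis :: "ntree \<Rightarrow> 'k::field" where
  "counit_basis t = (if t = unit_tree then 1 else 0)"

end

theory Submission
  imports Defs "HOL.Binomial"
begin

text \<open>
  The post-order word of a term of \<open>t * u\<close> is a shuffle of the post-order words of \<open>t\<close> and \<open>u\<close>,
  and every shuffle arises exactly once.  A forest is determined by its post-order word together
  with its descendant relation, and the descendant relation of the term belonging to a shuffle
  \<open>w\<close> is given by a formula in the order of the letters of \<open>w\<close>.  Associativity thus reduces to
  comparing two such formulas on triple shuffles, and compatibility with the coproduct to
  restricting them to a prefix and a suffix of \<open>w\<close>.  Standardization is harmless because the
  formula commutes with strictly increasing relabellings.  The antipode exists since the
  bialgebra is graded and connected.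
\<close>

subsection \<open>Forests\<close>

text \<open>A block grafted to the right of the children of a node puts its word immediately before
  the letter of that node. A partition of \<open>u\<close> with a strictly increasing map into the
  nodes of \<open>t\<close> is therefore a distribution of the word of \<open>u\<close>, in order,
  over \<open>deg t + 1\<close> slots: one in front of each letter of \<open>t\<close>, and one at
  the end for the unlabelled root. Slots may stay empty; the occupied ones recover the map, and the
  lengths of their contents recover the partition. This is why shuffles appear. That every shuffle
  is reached follows from counting: the map to shuffles is injective, and by Vandermonde's identity
  both sides have \<open>(m + n) choose m\<close> elements. No forest has to be built from a given
  shuffle. Iterated grafting cuts blocks that were themselves produced by grafting, so comparing the
  forests directly would mean tracking nested partitions. The descendant relation avoids this:
  whether \<open>y\<close> lies below \<open>x\<close> depends only on the letters standing between
  them. The link between the two descriptions is that descendants form a run of consecutive letters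
  in post-order.\<close>

lemma postF_simps [simp]:
  "postF [] = []" "postF (t # ts) = post t @ postF ts" "postF (ts @ us) = postF ts @ postF us"
  by (auto simp: postF_def)

lemma post_LN [simp]: "post (LN a cs) = postF cs @ [a]"
  by (simp add: postF_def)

declare post.simps [simp del]

lemma restrF_simps [simp]:
  "restrF A [] = []" "restrF A (t # ts) = restr A t @ restrF A ts"
  "restrF A (ts @ us) = restrF A ts @ restrF A us"
  by (auto simp: restrF_def)

lemma restr_LN [simp]:
  "restr A (LN a cs) = (if a \<in> A then [LN a (restrF A cs)] else restrF A cs)"
  by (simp add: restrF_def)

declare restr.simps [simp del]

lemma relabelF_simps [simp]:
  "relabelF g [] = []" "relabelF g (t # ts) = relabel g t # relabelF g ts"
  by (auto simp: relabelF_def)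

lemma relabel_LN [simp]: "relabel g (LN a cs) = LN (g a) (relabelF g cs)"
  by (simp add: relabelF_def)

declare relabel.simps [simp del]

text \<open>A nonempty forest consists of its first root, the forest of children of that root, and
  the remaining forest. Inducting on forests alone replaces the nested induction over trees and
  lists of trees.\<close>

lemma forest_induct [case_names Nil Cons]:
  assumes "P []" "\<And>a cs ts. P cs \<Longrightarrow> P ts \<Longrightarrow> P (LN a cs # ts)"
  shows "P (ts :: rtree)"
proof (induction "size_list size ts" arbitrary: ts rule: less_induct)
  case less
  show ?case
  proof (cases ts)
    case (Cons t us)
    obtain a cs where t: "t = LN a cs" by (cases t)
    show ?thesis unfolding Cons t by (rule assms(2); rule less) (simp_all add: Cons t)
  qed (simp add: assms(1))
qed

lemma postF_eq_Nil [simp]: "postF ts = [] \<longleftrightarrow> ts = []"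
  by (induction ts rule: forest_induct) auto

lemma postF_restrF [simp]: "postF (restrF A ts) = filter (\<lambda>a. a \<in> A) (postF ts)"
  by (induction ts rule: forest_induct) auto

lemma postF_relabelF [simp]: "postF (relabelF g ts) = map g (postF ts)"
  by (induction ts rule: forest_induct) auto

lemma restrF_restrF: "restrF A (restrF B ts) = restrF (A \<inter> B) ts"
  by (induction ts rule: forest_induct) auto

lemma restrF_cong: "A \<inter> set (postF ts) = B \<inter> set (postF ts) \<Longrightarrow> restrF A ts = restrF B ts"
proof (induction ts rule: forest_induct)
  case (Cons a cs ts)
  have "A \<inter> set (postF cs) = B \<inter> set (postF cs)" "A \<inter> set (postF ts) = B \<inter> set (postF ts)"
    using Cons.prems by (simp_all add: set_eq_iff) blast+
  moreover have "a \<in> A \<longleftrightarrow> a \<in> B" using Cons.prems by (auto simp: set_eq_iff)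
  ultimately show ?case using Cons.IH by simp
qed simp

lemma restrF_all: "set (postF ts) \<subseteq> A \<Longrightarrow> restrF A ts = ts"
  by (induction ts rule: forest_induct) auto

lemma restrF_none: "A \<inter> set (postF ts) = {} \<Longrightarrow> restrF A ts = []"
  by (induction ts rule: forest_induct) auto

lemma relabelF_relabelF: "relabelF f (relabelF g ts) = relabelF (\<lambda>a. f (g a)) ts"
  by (induction ts rule: forest_induct) auto

lemma relabelF_cong: "(\<And>a. a \<in> set (postF ts) \<Longrightarrow> f a = g a) \<Longrightarrow> relabelF f ts = relabelF g ts"
  by (induction ts rule: forest_induct) auto

lemma relabelF_id: "(\<And>a. a \<in> set (postF ts) \<Longrightarrow> f a = a) \<Longrightarrow> relabelF f ts = ts"
  by (induction ts rule: forest_induct) auto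

text \<open>Injectivity must cover \<open>A\<close> together with the letters: otherwise a letter
  outside \<open>A\<close> could be mapped into the image of \<open>A\<close> and survive the
  restriction.\<close>

lemma restrF_relabelF:
  assumes "inj_on g (set (postF ts) \<union> A)"
  shows "restrF (g ` A) (relabelF g ts) = relabelF g (restrF A ts)"
  using assms
proof (induction ts rule: forest_induct)
  case (Cons a cs ts)
  have i: "inj_on g (set (postF cs) \<union> A)" "inj_on g (set (postF ts) \<union> A)"
    using Cons.prems by (auto intro: inj_on_subset)
  have "g a \<in> g ` A \<longleftrightarrow> a \<in> A"
    using Cons.prems by (auto simp: inj_on_def)
  then show ?case using Cons.IH i by (auto simp: relabelF_def)
qed simp

subsection \<open>A forest is determined by its post-order word and its descendant relation\<close>

text \<open>A pair \<open>(y, x)\<close> has the proper descendant first, so that it agrees with the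
  order of the letters in post-order. The unlabelled root of a forest does not occur.\<close>

fun desc :: "ltree \<Rightarrow> (nat \<times> nat) set" where
  "desc (LN a cs) = (\<Union>c \<in> set cs. desc c) \<union> set (postF cs) \<times> {a}"

definition descF :: "rtree \<Rightarrow> (nat \<times> nat) set" where
  "descF ts = (\<Union>c \<in> set ts. desc c)"

lemma descF_simps [simp]:
  "descF [] = {}" "descF (t # ts) = desc t \<union> descF ts" "descF (ts @ us) = descF ts \<union> descF us"
  by (auto simp: descF_def)

lemma desc_LN [simp]: "desc (LN a cs) = descF cs \<union> set (postF cs) \<times> {a}"
  by (simp add: descF_def)

declare desc.simps [simp del]

lemma descF_subset: "descF ts \<subseteq> set (postF ts) \<times> set (postF ts)"
  by (induction ts rule: forest_induct) auto

lemma descF_restrF: "descF (restrF A ts) = descF ts \<inter> A \<times> A"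
  by (induction ts rule: forest_induct) auto

lemma descF_relabelF: "descF (relabelF g ts) = map_prod g g ` descF ts"
  by (induction ts rule: forest_induct) (auto simp: image_iff)

text \<open>The last letter is the root of the last tree, and its number of descendants tells how
  many of the preceding letters belong to that tree. So the word splits in the same place for both
  forests, and the relation restricts to the two shorter pieces.\<close>

lemma forest_eqI:
  "\<lbrakk>distinct (postF r); postF r = postF r'; descF r = descF r'\<rbrakk> \<Longrightarrow> r = r'"
proof (induction "length (postF r)" arbitrary: r r' rule: less_induct)
  case less
  show ?case
  proof (cases r rule: rev_cases)
    case Nil
    then show ?thesis using less.prems(2) by (metis postF_eq_Nil)
  next
    case r: (snoc ts t)
    then have "r' \<noteq> []" using less.prems(2) by (metis append_is_Nil_conv list.discI postF_eq_Nil)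
    then obtain ts' t' where r': "r' = ts' @ [t']" by (cases r' rule: rev_cases) auto
    obtain a cs where t: "t = LN a cs" by (cases t)
    obtain a' cs' where t': "t' = LN a' cs'" by (cases t')
    have a: "a' = a" and p: "postF ts @ postF cs = postF ts' @ postF cs'"
      using less.prems(2) by (simp_all add: r r' t t')
    have d: "distinct (postF ts @ postF cs @ [a])" using less.prems(1) by (simp add: r t)
    have d': "distinct (postF ts' @ postF cs' @ [a])"
      using less.prems(1,2) by (simp add: r' t' a)
    have D: "set (postF cs) = {y. (y, a) \<in> descF r}"
      using d descF_subset[of ts] descF_subset[of cs] by (auto simp: r t)
    have D': "set (postF cs') = {y. (y, a) \<in> descF r'}"
      using d' descF_subset[of ts'] descF_subset[of cs'] by (auto simp: r' t' a)
    have "length (postF cs) = card (set (postF cs))" "length (postF cs') = card (set (postF cs'))"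
      using d d' by (simp_all add: distinct_card)
    then have "length (postF cs) = length (postF cs')" using D D' less.prems(3) by simp
    then have p: "postF ts = postF ts'" "postF cs = postF cs'" using p by auto
    have "descF ts = descF r \<inter> set (postF ts) \<times> set (postF ts)"
      using d descF_subset[of ts] descF_subset[of cs] by (auto simp: r t)
    moreover have "descF ts' = descF r' \<inter> set (postF ts') \<times> set (postF ts')"
      using d' descF_subset[of ts'] descF_subset[of cs'] by (auto simp: r' t' a)
    moreover have "descF cs = descF r \<inter> set (postF cs) \<times> set (postF cs)"
      using d descF_subset[of ts] descF_subset[of cs] by (auto simp: r t)
    moreover have "descF cs' = descF r' \<inter> set (postF cs') \<times> set (postF cs')"
      using d' descF_subset[of ts'] descF_subset[of cs'] by (auto simp: r' t' a)
    ultimately have q: "descF ts = descF ts'" "descF cs = descF cs'"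
      using p less.prems(3) by simp_all
    have "ts = ts'" "cs = cs'"
      by (rule less.hyps; use d p q in \<open>simp add: r t\<close>)+
    then show ?thesis by (simp add: r r' t t' a)
  qed
qed

subsection \<open>The order of the letters of a word\<close>

text \<open>For a distinct word this is the strict order of positions. Being a set of pairs, it
  behaves well under appending, filtering and mapping, without any index arithmetic.\<close>

fun bef :: "'a list \<Rightarrow> ('a \<times> 'a) set" where
  "bef [] = {}"
| "bef (a # w) = {a} \<times> set w \<union> bef w"

lemma bef_append: "bef (v @ w) = bef v \<union> bef w \<union> set v \<times> set w"
  by (induction v) auto

lemma bef_subset: "bef w \<subseteq> set w \<times> set w"
  by (induction w) auto

lemma befD: "(y, x) \<in> bef w \<Longrightarrow> y \<in> set w" "(y, x) \<in> bef w \<Longrightarrow> x \<in> set w"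
  using bef_subset by auto

lemma bef_trans: "distinct w \<Longrightarrow> (x, y) \<in> bef w \<Longrightarrow> (y, z) \<in> bef w \<Longrightarrow> (x, z) \<in> bef w"
  by (induction w) (auto dest: befD)

lemma bef_asym: "distinct w \<Longrightarrow> (x, y) \<in> bef w \<Longrightarrow> (y, x) \<notin> bef w"
  by (induction w) (auto dest: befD)

lemma bef_filter: "bef (filter P w) = bef w \<inter> {x. P x} \<times> {x. P x}"
  by (induction w) auto

lemma bef_map: "bef (map g w) = map_prod g g ` bef w"
  by (induction w) auto

lemma bef_concat_upt:
  "bef (concat (map f [0..<m])) =
     (\<Union>p<m. bef (f p)) \<union> {(y, x). \<exists>p q. p < q \<and> q < m \<and> y \<in> set (f p) \<and> x \<in> set (f q)}"
proof (induction m)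
  case (Suc m)
  let ?R = "\<lambda>m. {(y, x). \<exists>p q. p < q \<and> q < m \<and> y \<in> set (f p) \<and> x \<in> set (f q)}"
  have "?R (Suc m) = ?R m \<union> (\<Union>p<m. set (f p)) \<times> set (f m)"
    by (auto simp: less_Suc_eq; blast)
  then show ?case
    by (auto simp: bef_append Suc lessThan_Suc lessThan_atLeast0[symmetric])
qed simp

lemma bef_concat_upt_block:
  "p < m \<Longrightarrow> (y, x) \<in> bef (f p) \<Longrightarrow> (y, x) \<in> bef (concat (map f [0..<m]))"
  by (auto simp: bef_concat_upt)

lemma bef_concat_upt_blocks:
  "p < q \<Longrightarrow> q < m \<Longrightarrow> y \<in> set (f p) \<Longrightarrow> x \<in> set (f q) \<Longrightarrow> (y, x) \<in> bef (concat (map f [0..<m]))"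
  by (auto simp: bef_concat_upt)

lemma descF_bef: "descF ts \<subseteq> bef (postF ts)"
  by (induction ts rule: forest_induct) (auto simp: bef_append)

text \<open>The word of the children of a node stands directly in front of that node, so its
  descendants form an uninterrupted run ending there. This lets one letter of \<open>t\<close> speak
  for all letters between it and an ancestor.\<close>

lemma descF_convex:
  "\<lbrakk>distinct (postF ts); (y, x) \<in> descF ts; (y, z) \<in> bef (postF ts); (z, x) \<in> bef (postF ts)\<rbrakk>
    \<Longrightarrow> (z, x) \<in> descF ts"
proof (induction ts rule: forest_induct)
  case (Cons a cs ts)
  show ?case
  proof (cases "x \<in> set (postF ts)")
    case True
    then have "(y, x) \<in> descF ts"
      using Cons.prems(1,2) descF_subset[of ts] descF_subset[of cs] by auto
    then have "y \<in> set (postF ts)" using descF_subset by blast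
    then have "z \<in> set (postF ts)" using Cons.prems(1,3) by (auto simp: bef_append dest: befD)
    then have "(y, z) \<in> bef (postF ts)" "(z, x) \<in> bef (postF ts)"
      using Cons.prems(1,3,4) \<open>y \<in> set (postF ts)\<close> by (auto simp: bef_append dest: befD)
    then show ?thesis using Cons.IH(2) Cons.prems(1) \<open>(y, x) \<in> descF ts\<close> by simp
  next
    case False
    then have z: "z \<in> set (postF cs) \<or> z = a" using Cons.prems(4) by (auto simp: bef_append dest: befD)
    show ?thesis
    proof (cases "x = a")
      case True
      then have "z \<noteq> a" using bef_asym[OF Cons.prems(1) Cons.prems(4)] Cons.prems(4) by auto
      then show ?thesis using z True by simp
    next
      case xa: False
      then have yx: "(y, x) \<in> descF cs"
        using Cons.prems(2) False descF_subset[of ts] by auto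
      then have "x \<in> set (postF cs)" "y \<in> set (postF cs)" using descF_subset by blast+
      then have "(y, z) \<in> bef (postF cs)" "(z, x) \<in> bef (postF cs)"
        using Cons.prems(1,3,4) z xa False by (auto simp: bef_append dest: befD)
      then show ?thesis using Cons.IH(1) Cons.prems(1) yx by simp
    qed
  qed
qed simp

subsection \<open>Gluing along a shuffle\<close>

text \<open>Disjointness makes the two restrictions complementary, so they split the word into two
  parts whose shuffles contain it. Orders inside \<open>xs\<close> and \<open>ys\<close> can then be
  read off from \<open>bef\<close> of the shuffle.\<close>

lemma in_shuffles_iff:
  assumes "set xs \<inter> set ys = {}"
  shows "zs \<in> shuffles xs ys \<longleftrightarrow> set zs \<subseteq> set xs \<union> set ys \<and>
    filter (\<lambda>x. x \<in> set xs) zs = xs \<and> filter (\<lambda>x. x \<in> set ys) zs = ys"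
proof
  assume "zs \<in> shuffles xs ys"
  then show "set zs \<subseteq> set xs \<union> set ys \<and>
    filter (\<lambda>x. x \<in> set xs) zs = xs \<and> filter (\<lambda>x. x \<in> set ys) zs = ys"
    using filter_shuffles_disjoint1[OF assms] filter_shuffles_disjoint2[OF assms]
    by (auto dest: set_shuffles)
next
  assume *: "set zs \<subseteq> set xs \<union> set ys \<and>
    filter (\<lambda>x. x \<in> set xs) zs = xs \<and> filter (\<lambda>x. x \<in> set ys) zs = ys"
  then have "filter (\<lambda>x. x \<notin> set xs) zs = filter (\<lambda>x. x \<in> set ys) zs"
    using assms by (intro filter_cong) auto
  then show "zs \<in> shuffles xs ys"
    using partition_in_shuffles[of zs "\<lambda>x. x \<in> set xs"] * by simp
qed

text \<open>A node of u keeps its descendants within its own block, that is, those not separated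
  from it by a letter of t; a node of t also acquires the blocks attached to itself and to
  its descendants.\<close>

definition glue_desc :: "rtree \<Rightarrow> rtree \<Rightarrow> nat list \<Rightarrow> (nat \<times> nat) set" where
  "glue_desc t u w = {(y, x) \<in> bef w.
     (y, x) \<in> descF t \<or>
     x \<in> set (postF t) \<and> y \<in> set (postF u) \<and>
       (\<forall>z \<in> set (postF t). (y, z) \<in> bef w \<longrightarrow> (z, x) \<in> bef w \<longrightarrow> (z, x) \<in> descF t) \<or>
     (y, x) \<in> descF u \<and> (\<forall>z \<in> set (postF t). (y, z) \<in> bef w \<longrightarrow> (z, x) \<notin> bef w)}"

text \<open>A choice instead of a construction: \<open>forest_eqI\<close> makes it unique for a
  distinct word, and for a shuffle existence comes from the grafting data that produce it
  (\<open>glue_props\<close>).\<close>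

definition glue :: "rtree \<Rightarrow> rtree \<Rightarrow> nat list \<Rightarrow> rtree" where
  "glue t u w = (SOME r. postF r = w \<and> descF r = glue_desc t u w)"

lemma glueI:
  assumes "distinct w" "postF r = w" "descF r = glue_desc t u w"
  shows "glue t u w = r"
proof -
  have "postF (glue t u w) = w \<and> descF (glue t u w) = glue_desc t u w"
    unfolding glue_def by (rule someI[of _ r]) (use assms in auto)
  then show ?thesis using assms by (intro forest_eqI) auto
qed

text \<open>New children go to the right of the old ones, so their word comes last before the letter
  of the node itself. This placement turns grafting into shuffling.\<close>

lemma postF_graftL:
  "postF (map (graftL h) ts) = concat (map (\<lambda>a. postF (h a) @ [a]) (postF ts))"
  by (induction ts rule: forest_induct) auto

text \<open>A grafted letter lies below the node \<open>a\<close> that receives it and below all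
  ancestors of \<open>a\<close>; inside one grafted forest nothing changes.\<close>

lemma descF_graftL:
  "descF (map (graftL h) ts) = descF ts \<union>
     {(y, x). \<exists>a \<in> set (postF ts). y \<in> set (postF (h a)) \<and> (a = x \<or> (a, x) \<in> descF ts)} \<union>
     (\<Union>a \<in> set (postF ts). descF (h a))"
proof (induction ts rule: forest_induct)
  case (Cons a cs ts)
  let ?H = "\<lambda>ts. {(y, x). \<exists>a \<in> set (postF ts). y \<in> set (postF (h a)) \<and> (a = x \<or> (a, x) \<in> descF ts)}"
  have *: "b \<in> set (postF ts)" "c \<in> set (postF ts)" if "(b, c) \<in> descF ts" for b c ts
    using that descF_subset by blast+
  have "(y, x) \<in> ?H (LN a cs # ts) \<longleftrightarrow> (y, x) \<in> ?H cs \<union> ?H ts \<or>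
      x = a \<and> y \<in> (\<Union>b \<in> set (postF cs). set (postF (h b))) \<union> set (postF (h a))" for x y
    using *[of _ x cs] *[of _ x ts] by (simp del: split_paired_Ex) blast
  then have "?H (LN a cs # ts) = ?H cs \<union> ?H ts \<union>
      ((\<Union>b \<in> set (postF cs). set (postF (h b))) \<union> set (postF (h a))) \<times> {a}"
    by (simp only: set_eq_iff split_paired_All) blast
  moreover have "set (postF (map (graftL h) cs)) = (\<Union>b \<in> set (postF cs). set (postF (h b))) \<union> set (postF cs)"
    by (auto simp: postF_graftL)
  ultimately show ?case
    by (simp add: Cons) blast
qed simp

section \<open>Grafting a fixed distribution of blocks over the slots of \<open>t\<close>\<close>

lemma in_set_concat_upt: "x \<in> set (concat (map f [0..<m])) \<longleftrightarrow> (\<exists>p<m. x \<in> set (f p))"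
  by auto

lemma filter_middle: "distinct (xs @ ys @ zs) \<Longrightarrow> filter (\<lambda>a. a \<in> set ys) (xs @ ys @ zs) = ys"
proof -
  assume d: "distinct (xs @ ys @ zs)"
  then have "filter (\<lambda>a. a \<in> set ys) xs = []" "filter (\<lambda>a. a \<in> set ys) zs = []"
    by (auto simp: filter_empty_conv)
  then show ?thesis by simp
qed

text \<open>\<open>B p\<close> is the word of the block attached to the node at post-order position
  \<open>p\<close>, empty if nothing is attached; position \<open>m\<close> is the root. The single
  total function \<open>B\<close> stands for the partition and the map together.\<close>

locale block_graft =
  fixes t u :: rtree and B :: "nat \<Rightarrow> nat list" and m :: nat
  assumes dt: "distinct (postF t)" and du: "distinct (postF u)"
    and disj: "set (postF t) \<inter> set (postF u) = {}"
    and concat_B: "concat (map B [0..<Suc m]) = postF u"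
    and m: "m = deg t"
begin

text \<open>The \<open>if\<close> singles out the last slot: it belongs to the root, which carries
  no label and contributes no letter.\<close>

definition "W = concat (map (\<lambda>p. B p @ (if p < m then [postF t ! p] else [])) [0..<Suc m])"

definition "h a = (case map_of (zip (postF t) [0..<m]) a of None \<Rightarrow> []
  | Some p \<Rightarrow> restrF (set (B p)) u)"

definition "r = map (graftL h) t @ restrF (set (B m)) u"

lemma len: "length (postF t) = m"
  by (simp add: m deg_def)

lemma B_subset: "p \<le> m \<Longrightarrow> set (B p) \<subseteq> set (postF u)"
  using arg_cong[OF concat_B, of set] by (simp del: upt_Suc) fastforce

lemma B_cover: "y \<in> set (postF u) \<Longrightarrow> \<exists>p\<le>m. y \<in> set (B p)"
proof -
  assume "y \<in> set (postF u)"
  then have "y \<in> set (concat (map B [0..<Suc m]))" by (simp only: concat_B)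
  then obtain p where "p < Suc m" "y \<in> set (B p)" unfolding in_set_concat_upt by blast
  then show ?thesis using less_Suc_eq_le by blast
qed

lemma bef_B: "p < q \<Longrightarrow> q \<le> m \<Longrightarrow> y \<in> set (B p) \<Longrightarrow> x \<in> set (B q) \<Longrightarrow> (y, x) \<in> bef (postF u)"
  by (subst concat_B[symmetric], subst bef_concat_upt) auto

lemma B_unique:
  assumes "y \<in> set (B p)" "y \<in> set (B q)" "p \<le> m" "q \<le> m"
  shows "p = q"
proof (rule ccontr)
  assume "p \<noteq> q"
  then have "(y, y) \<in> bef (postF u)"
    using bef_B[of p q y y] bef_B[of q p y y] assms by linarith
  then show False using bef_asym[OF du] by blast
qed

lemma filter_B: "p \<le> m \<Longrightarrow> filter (\<lambda>a. a \<in> set (B p)) (postF u) = B p"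
proof -
  assume p: "p \<le> m"
  then have "[0..<Suc m] = [0..<p] @ p # [Suc p..<Suc m]"
    by (metis le_imp_less_Suc upt_conv_Cons zero_le upt_add_eq_append le_add_diff_inverse less_imp_le add_0)
  then have e: "postF u = concat (map B [0..<p]) @ B p @ concat (map B [Suc p..<Suc m])"
    by (subst concat_B[symmetric]) simp
  have "distinct (concat (map B [0..<p]) @ B p @ concat (map B [Suc p..<Suc m]))"
    using du e by simp
  then show ?thesis unfolding e by (rule filter_middle)
qed

lemma postF_block: "p \<le> m \<Longrightarrow> postF (restrF (set (B p)) u) = B p"
  by (simp add: filter_B)

lemma h_nth: "p < m \<Longrightarrow> h (postF t ! p) = restrF (set (B p)) u"
proof -
  assume p: "p < m"
  have "map_of (zip (postF t) [0..<m]) (postF t ! p) = Some ([0..<m] ! p)"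
    by (rule map_of_zip_nth) (use len dt p in auto)
  then show ?thesis using p by (simp add: h_def)
qed

lemma postF_r: "postF r = W"
proof -
  have "postF r = concat (map (\<lambda>a. postF (h a) @ [a]) (map ((!) (postF t)) [0..<m])) @ B m"
  proof -
    have "map ((!) (postF t)) [0..<m] = postF t" by (metis len map_nth)
    then show ?thesis by (simp add: r_def postF_graftL filter_B)
  qed
  also have "map (\<lambda>a. postF (h a) @ [a]) (map ((!) (postF t)) [0..<m]) =
      map (\<lambda>p. B p @ [postF t ! p]) [0..<m]"
    by (auto simp: h_nth filter_B)
  also have "\<dots> = map (\<lambda>p. B p @ (if p < m then [postF t ! p] else [])) [0..<m]"
    by auto
  finally show ?thesis by (simp add: W_def)
qed

lemma set_t: "set (postF t) = {postF t ! p | p. p < m}"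
  using len by (auto simp: set_conv_nth)

lemma W_shuffle: "W \<in> shuffles (postF t) (postF u)"
  unfolding in_shuffles_iff[OF disj]
proof (intro conjI)
  have T: "postF t ! p \<in> set (postF t)" if "p < m" for p using that len by simp
  show "set W \<subseteq> set (postF t) \<union> set (postF u)"
  proof
    fix x assume "x \<in> set W"
    then obtain p where p: "p < Suc m" "x \<in> set (B p @ (if p < m then [postF t ! p] else []))"
      unfolding W_def in_set_concat_upt by blast
    from p(2) have "x \<in> set (B p) \<or> p < m \<and> x = postF t ! p" by (cases "p < m") auto
    moreover have "p \<le> m" using p(1) by simp
    ultimately show "x \<in> set (postF t) \<union> set (postF u)" using T B_subset by blast
  qed
  have "filter (\<lambda>x. x \<in> set (postF t)) W =
      concat (map (\<lambda>p. if p < m then [postF t ! p] else []) [0..<Suc m])"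
    unfolding W_def filter_concat map_map comp_def
  proof (intro arg_cong[of _ _ concat] map_cong refl)
    fix p assume "p \<in> set [0..<Suc m]"
    then have "filter (\<lambda>x. x \<in> set (postF t)) (B p) = []"
      using B_subset[of p] disj by (auto simp: filter_empty_conv less_Suc_eq_le simp del: upt_Suc)
    then show "filter (\<lambda>x. x \<in> set (postF t)) (B p @ (if p < m then [postF t ! p] else [])) =
        (if p < m then [postF t ! p] else [])" using T by simp
  qed
  also have "\<dots> = map ((!) (postF t)) [0..<m]"
  proof -
    have "concat (map (\<lambda>p. if p < m then [postF t ! p] else []) [0..<m]) =
        concat (map (\<lambda>p. [postF t ! p]) [0..<m])"
      by (intro arg_cong[of _ _ concat] map_cong) auto
    then show ?thesis by simp
  qed
  finally show "filter (\<lambda>x. x \<in> set (postF t)) W = postF t" by (metis len map_nth)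
  have "filter (\<lambda>x. x \<in> set (postF u)) W = concat (map B [0..<Suc m])"
    unfolding W_def filter_concat map_map comp_def
  proof (intro arg_cong[of _ _ concat] map_cong refl)
    fix p assume "p \<in> set [0..<Suc m]"
    then have "filter (\<lambda>x. x \<in> set (postF u)) (B p) = B p"
      using B_subset[of p] by (auto simp: filter_id_conv less_Suc_eq_le simp del: upt_Suc)
    moreover have "postF t ! p \<notin> set (postF u)" if "p < m" using T[OF that] disj by blast
    ultimately show "filter (\<lambda>x. x \<in> set (postF u)) (B p @ (if p < m then [postF t ! p] else [])) = B p"
      by simp
  qed
  then show "filter (\<lambda>x. x \<in> set (postF u)) W = postF u" by (simp only: concat_B)
qed

lemma distinct_W: "distinct W"
  using distinct_disjoint_shuffles[OF dt du disj W_shuffle] .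

lemma bef_u: "(y, x) \<in> bef (postF u) \<Longrightarrow> (y, x) \<in> bef W"
  using W_shuffle bef_filter[of "\<lambda>x. x \<in> set (postF u)" W] by (auto simp: in_shuffles_iff[OF disj])

lemma bef_t: "(y, x) \<in> bef (postF t) \<Longrightarrow> (y, x) \<in> bef W"
  using W_shuffle bef_filter[of "\<lambda>x. x \<in> set (postF t)" W] by (auto simp: in_shuffles_iff[OF disj])

lemma bef_W_Bt0:
  assumes "y \<in> set (B p)" "p \<le> q" "q < m"
  shows "(y, postF t ! q) \<in> bef W"
proof (cases "p = q")
  case True
  show ?thesis
    unfolding W_def by (rule bef_concat_upt_block[of q]) (use assms True in \<open>simp_all add: bef_append\<close>)
next
  case False
  show ?thesis
    unfolding W_def by (rule bef_concat_upt_blocks[of p q]) (use assms False in simp_all)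
qed

lemma bef_W_tB0:
  assumes "y \<in> set (B p)" "q < p" "p \<le> m"
  shows "(postF t ! q, y) \<in> bef W"
  unfolding W_def by (rule bef_concat_upt_blocks[of q p]) (use assms in simp_all)

text \<open>Slot \<open>p\<close> lies just before letter \<open>p\<close> of \<open>t\<close>,
  hence the weak inequality here and the strict one for the opposite order. These comparisons
  translate slot numbers into the order of the word.\<close>

lemma bef_W_Bt: "y \<in> set (B p) \<Longrightarrow> p \<le> m \<Longrightarrow> q < m \<Longrightarrow> (y, postF t ! q) \<in> bef W \<longleftrightarrow> p \<le> q"
  using bef_W_Bt0[of y p q] bef_W_tB0[of y p q] bef_asym[OF distinct_W, of y "postF t ! q"]
  by (cases "p \<le> q") auto

lemma bef_W_tB: "y \<in> set (B p) \<Longrightarrow> p \<le> m \<Longrightarrow> q < m \<Longrightarrow> (postF t ! q, y) \<in> bef W \<longleftrightarrow> q < p"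
  using bef_W_Bt0[of y p q] bef_W_tB0[of y p q] bef_asym[OF distinct_W, of y "postF t ! q"]
  by (cases "p \<le> q") auto

lemma bef_nth: "p < q \<Longrightarrow> q < m \<Longrightarrow> (postF t ! p, postF t ! q) \<in> bef (postF t)"
proof -
  assume *: "p < q" "q < m"
  have "(postF t ! p, postF t ! q) \<in> bef (concat (map (\<lambda>p. [postF t ! p]) [0..<m]))"
    unfolding bef_concat_upt using * by auto
  moreover have "concat (map (\<lambda>p. [postF t ! p]) [0..<m]) = postF t"
    unfolding concat_map_singleton len[symmetric] by (rule map_nth)
  ultimately show ?thesis by simp
qed

lemma bef_W_tt: "p < m \<Longrightarrow> q < m \<Longrightarrow> (postF t ! p, postF t ! q) \<in> bef W \<longleftrightarrow> p < q"
  using bef_t[OF bef_nth[of p q]] bef_t[OF bef_nth[of q p]]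
    bef_asym[OF distinct_W, of "postF t ! p" "postF t ! q"]
  by (cases p q rule: linorder_cases) auto

text \<open>In terms of slots the relation is explicit; it remains to express it by order alone. For
  \<open>y\<close> in slot \<open>p\<close>, the next letter of \<open>t\<close> is letter
  \<open>p\<close>. Hence \<open>y\<close> lies below a letter \<open>x\<close> of \<open>t\<close>
  iff letter \<open>p\<close> equals \<open>x\<close> or lies below it, and by convexity iff all
  letters of \<open>t\<close> between \<open>y\<close> and \<open>x\<close> lie below
  \<open>x\<close>.\<close>

lemma descF_r: "descF r = glue_desc t u W"
proof -
  have main: "descF r = descF t \<union>
     {(y, x). \<exists>p<m. y \<in> set (B p) \<and> (postF t ! p = x \<or> (postF t ! p, x) \<in> descF t)} \<union>
     {(y, x) \<in> descF u. \<exists>p\<le>m. y \<in> set (B p) \<and> x \<in> set (B p)}" (is "_ = _ \<union> ?X \<union> ?Y")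
  proof -
    have 1: "(\<exists>a \<in> set (postF t). P a) \<longleftrightarrow> (\<exists>p<m. P (postF t ! p))" for P
      by (auto simp: set_t)
    have 2: "(\<Union>a \<in> set (postF t). descF (h a)) = (\<Union>p<m. descF u \<inter> set (B p) \<times> set (B p))"
    proof -
      have "set (postF t) = (!) (postF t) ` {..<m}" by (auto simp: set_t)
      then have "(\<Union>a \<in> set (postF t). descF (h a)) = (\<Union>p<m. descF (h (postF t ! p)))" by simp
      also have "\<dots> = (\<Union>p<m. descF u \<inter> set (B p) \<times> set (B p))"
        by (intro SUP_cong) (simp_all add: h_nth descF_restrF)
      finally show ?thesis .
    qed
    have 3: "?Y = (\<Union>p<m. descF u \<inter> set (B p) \<times> set (B p)) \<union> descF u \<inter> set (B m) \<times> set (B m)"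
      by (auto simp: le_less)
    have 4: "?X = {(y, x). \<exists>p<m. y \<in> set (postF (h (postF t ! p))) \<and>
        (postF t ! p = x \<or> (postF t ! p, x) \<in> descF t)}"
      by (auto simp: h_nth postF_block simp del: postF_restrF)
    show ?thesis
      unfolding r_def descF_simps descF_graftL 1 2 3 4 descF_restrF by blast
  qed
  have D: "descF t = {(y, x) \<in> bef W. (y, x) \<in> descF t}"
    using descF_bef bef_t by fastforce
  have X: "?X = {(y, x) \<in> bef W. x \<in> set (postF t) \<and> y \<in> set (postF u) \<and>
       (\<forall>z \<in> set (postF t). (y, z) \<in> bef W \<longrightarrow> (z, x) \<in> bef W \<longrightarrow> (z, x) \<in> descF t)}" (is "_ = ?X'")
  proof (intro equalityI subrelI)
    fix y x assume "(y, x) \<in> ?X"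
    then obtain p where p: "p < m" "y \<in> set (B p)"
      and px: "postF t ! p = x \<or> (postF t ! p, x) \<in> descF t" by blast
    have "x \<in> set (postF t)" using px p len descF_subset[of t] by auto
    then obtain q where q: "q < m" "x = postF t ! q" by (auto simp: set_t)
    have pq: "p = q \<or> p < q \<and> (postF t ! p, postF t ! q) \<in> descF t"
    proof (cases "postF t ! p = x")
      case True
      then show ?thesis using q p dt len by (simp add: nth_eq_iff_index_eq)
    next
      case False
      then have "(postF t ! p, postF t ! q) \<in> descF t" using px q by simp
      moreover from this have "p < q" using descF_bef bef_t bef_W_tt p(1) q(1) by blast
      ultimately show ?thesis by simp
    qed
    have "(z, x) \<in> descF t" if z: "z \<in> set (postF t)" "(y, z) \<in> bef W" "(z, x) \<in> bef W" for z
    proof -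
      obtain s where s: "s < m" "z = postF t ! s" using z(1) by (auto simp: set_t)
      have ps: "p \<le> s" "s < q"
        using z(2,3) s p q bef_W_Bt[of y p s] bef_W_tt[of s q] by simp_all
      then have pq: "(postF t ! p, postF t ! q) \<in> descF t" using pq by auto
      show ?thesis
      proof (cases "p = s")
        case False
        then have "p < s" using ps by simp
        \<comment> \<open>Letter \<open>s\<close> stands between letter \<open>p\<close> and its
          ancestor, letter \<open>q\<close>, so convexity puts it below letter \<open>q\<close> as
          well.\<close>
        then show ?thesis
          using descF_convex[OF dt pq] bef_nth[of p s] bef_nth[of s q] ps s q by simp
      qed (use pq s q in simp)
    qed
    moreover have "(y, x) \<in> bef W" using bef_W_Bt[of y p q] p q pq by auto
    moreover have "y \<in> set (postF u)" using p B_subset by (meson less_imp_le subsetD)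
    ultimately show "(y, x) \<in> ?X'" using \<open>x \<in> set (postF t)\<close> by blast
  next
    fix y x assume X: "(y, x) \<in> ?X'"
    then obtain q where q: "q < m" "x = postF t ! q" by (auto simp: set_t)
    obtain p where p: "p \<le> m" "y \<in> set (B p)" using B_cover X by blast
    have pq: "p \<le> q" using X bef_W_Bt[of y p q] p q by simp
    have "postF t ! p = x \<or> (postF t ! p, x) \<in> descF t"
    proof (cases "p = q")
      case False
      then have "p < q" using pq by simp
      \<comment> \<open>The quantified condition is tested on the first letter of \<open>t\<close>
        after \<open>y\<close>.\<close>
      then have "(y, postF t ! p) \<in> bef W" "(postF t ! p, x) \<in> bef W" "postF t ! p \<in> set (postF t)"
        using bef_W_Bt[of y p p] bef_W_tt[of p q] p q len by simp_all
      then show ?thesis using X by blast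
    qed (simp add: q)
    moreover have "p < m" using pq q(1) by simp
    ultimately show "(y, x) \<in> ?X" using p(2) by blast
  qed
  have Y: "?Y = {(y, x) \<in> bef W. (y, x) \<in> descF u \<and>
      (\<forall>z \<in> set (postF t). (y, z) \<in> bef W \<longrightarrow> (z, x) \<notin> bef W)}" (is "_ = ?Y'")
  proof (intro equalityI subrelI)
    fix y x assume "(y, x) \<in> ?Y"
    then obtain p where p: "p \<le> m" "y \<in> set (B p)" "x \<in> set (B p)" and yx: "(y, x) \<in> descF u" by auto
    have "(z, x) \<notin> bef W" if z: "z \<in> set (postF t)" "(y, z) \<in> bef W" for z
    proof -
      obtain s where s: "s < m" "z = postF t ! s" using z(1) by (auto simp: set_t)
      then show ?thesis using z(2) bef_W_Bt[of y p s] bef_W_tB[of x p s] p by simp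
    qed
    moreover have "(y, x) \<in> bef W" using yx descF_bef bef_u by blast
    ultimately show "(y, x) \<in> ?Y'" using yx by blast
  next
    fix y x assume Y: "(y, x) \<in> ?Y'"
    then have xy: "x \<in> set (postF u)" "y \<in> set (postF u)" using descF_subset by blast+
    obtain p where p: "p \<le> m" "y \<in> set (B p)" using B_cover xy by blast
    obtain q where q: "q \<le> m" "x \<in> set (B q)" using B_cover xy by blast
    have "\<not> p < q"
    proof
      assume pq: "p < q"
      \<comment> \<open>Letter \<open>p\<close> closes slot \<open>p\<close>, so it separates
        \<open>y\<close> from every later slot.\<close>
      then have "(y, postF t ! p) \<in> bef W" "(postF t ! p, x) \<in> bef W" "postF t ! p \<in> set (postF t)"
        using bef_W_Bt[of y p p] bef_W_tB[of x q p] p q len by simp_all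
      then show False using Y by blast
    qed
    moreover have "\<not> q < p"
      using bef_B[of q p x y] p q bef_u bef_asym[OF distinct_W, of y x] Y by blast
    ultimately have "p = q" by simp
    then show "(y, x) \<in> ?Y" using Y p q by blast
  qed
  show ?thesis unfolding main X Y glue_desc_def by (subst D) blast
qed

lemma r_glue: "r = glue t u W"
  using glueI[OF distinct_W postF_r descF_r] by simp

text \<open>The block of a letter is the number of letters of t preceding it, so the blocks can be
  read off the shuffle.\<close>

lemma B_eq_filter:
  assumes p: "p \<le> m"
  shows "B p = filter (\<lambda>y. card {z \<in> set (postF t). (z, y) \<in> bef W} = p) (postF u)"
proof -
  have "card {z \<in> set (postF t). (z, y) \<in> bef W} = p \<longleftrightarrow> y \<in> set (B p)" if y: "y \<in> set (postF u)" for y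
  proof -
    obtain q where q: "q \<le> m" "y \<in> set (B q)" using B_cover y by blast
    have "{z \<in> set (postF t). (z, y) \<in> bef W} = (!) (postF t) ` {..<q}"
      using q bef_W_tB[of y q] by (auto simp: set_t)
    moreover have "inj_on ((!) (postF t)) {..<q}"
      using q len dt by (auto simp: inj_on_def nth_eq_iff_index_eq)
    ultimately have "card {z \<in> set (postF t). (z, y) \<in> bef W} = q" by (simp add: card_image)
    then show ?thesis using q p B_unique by blast
  qed
  then have "filter (\<lambda>y. card {z \<in> set (postF t). (z, y) \<in> bef W} = p) (postF u) =
      filter (\<lambda>y. y \<in> set (B p)) (postF u)"
    by (intro filter_cong refl)
  then show ?thesis using filter_B[OF p] by simp
qed

end

section \<open>Cutting a word into segments and placing them in slots\<close>

definition segments :: "'a list \<Rightarrow> nat list \<Rightarrow> 'a list list" where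
  "segments U cs = map (\<lambda>(i, j). drop i (take j U)) (zip cs (tl cs))"

lemma segments_simps [simp]:
  "segments U [] = []" "segments U [i] = []"
  "segments U (i # j # cs) = drop i (take j U) # segments U (j # cs)"
  by (simp_all add: segments_def)

lemma length_segments: "length (segments U cs) = length cs - 1"
  by (simp add: segments_def)

lemma concat_segments:
  "sorted (c # cs) \<Longrightarrow> concat (segments U (c # cs)) = drop c (take (last (c # cs)) U)"
proof (induction cs arbitrary: c)
  case (Cons j cs)
  define l where "l = last (j # cs)"
  have "j \<le> l" using Cons.prems unfolding l_def by (metis last_in_set list.distinct(1) set_ConsD sorted_simps(2) order_refl)
  have cj: "c \<le> j" using Cons.prems by simp
  have "concat (segments U (c # j # cs)) = drop c (take j U) @ drop j (take l U)"
    using Cons by (simp add: l_def)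
  also have "\<dots> = drop c (take l U)"
  proof (cases "j \<le> length U")
    case True
    have "take l U = take j U @ drop j (take l U)"
      using \<open>j \<le> l\<close> by (metis append_take_drop_id min.absorb1 take_take)
    then have "drop c (take l U) = drop c (take j U @ drop j (take l U))" by (rule arg_cong)
    then show ?thesis using True cj by simp
  qed (use \<open>j \<le> l\<close> in simp)
  finally show ?case by (simp add: l_def)
qed simp

lemma segments_nonempty:
  "sorted cs \<Longrightarrow> distinct cs \<Longrightarrow> \<forall>c \<in> set cs. c \<le> length U \<Longrightarrow> [] \<notin> set (segments U cs)"
proof (induction cs)
  case (Cons c cs)
  then show ?case by (cases cs) (auto simp: le_less)
qed simp

text \<open>The length of the first segment gives the next cut point, and so on. The bound by
  \<open>length U\<close> matters because \<open>take\<close> saturates: cut points beyond the end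
  would be indistinguishable.\<close>

lemma segments_inj:
  "\<lbrakk>segments U (c # cs) = segments U (c # cs'); sorted (c # cs); sorted (c # cs');
    \<forall>i \<in> set cs \<union> set cs'. i \<le> length U\<rbrakk> \<Longrightarrow> cs = cs'"
proof (induction cs arbitrary: c cs')
  case Nil
  then show ?case by (cases cs') auto
next
  case (Cons j cs)
  then obtain j' cs'' where cs': "cs' = j' # cs''" by (cases cs') auto
  have "drop c (take j U) = drop c (take j' U)" using Cons.prems(1) cs' by simp
  then have "length (drop c (take j U)) = length (drop c (take j' U))" by (rule arg_cong)
  then have "j = j'" using Cons.prems(2-4) cs' by auto
  then show ?case using Cons.IH[of j cs''] Cons.prems cs' by simp
qed

text \<open>The default \<open>[]\<close> extends an assignment of segments to chosen slots to all
  slots, as \<open>block_graft\<close> demands, without affecting the concatenation.\<close>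

definition place :: "nat list \<Rightarrow> 'a list list \<Rightarrow> nat \<Rightarrow> 'a list" where
  "place fs bs p = (case map_of (zip fs bs) p of None \<Rightarrow> [] | Some b \<Rightarrow> b)"

lemma place_notin: "p \<notin> set fs \<Longrightarrow> place fs bs p = []"
proof -
  assume "p \<notin> set fs"
  then have "map_of (zip fs bs) p = None" by (auto simp: map_of_eq_None_iff dest: set_zip_leftD)
  then show ?thesis by (simp add: place_def)
qed

lemma map_place:
  assumes "length fs = length bs" "distinct fs"
  shows "map (place fs bs) fs = bs"
  using assms by (intro nth_equalityI) (simp_all add: place_def map_of_zip_nth)

lemma concat_place:
  assumes "length fs = length bs" "sorted fs" "distinct fs" "\<forall>f \<in> set fs. s \<le> f \<and> f < M"
  shows "concat (map (place fs bs) [s..<M]) = concat bs"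
  using assms
proof (induction fs arbitrary: bs s)
  case Nil
  then show ?case by (simp add: place_notin)
next
  case (Cons f fs)
  then obtain b bs' where bs: "bs = b # bs'" by (cases bs) auto
  have f: "s \<le> f" "f < M" using Cons.prems by auto
  have gt: "\<forall>g \<in> set fs. f < g" using Cons.prems(2,3) by (auto simp: le_less)
  have "[s..<M] = [s..<f] @ f # [Suc f..<M]"
    using f by (metis le_add_diff_inverse less_imp_le upt_add_eq_append upt_conv_Cons)
  moreover have "concat (map (place (f # fs) bs) [s..<f]) = []"
  proof -
    have "place (f # fs) bs p = []" if "p < f" for p
      using gt that by (intro place_notin) force
    then show ?thesis by (simp add: concat_eq_Nil_conv)
  qed
  moreover have "place (f # fs) bs f = b" by (simp add: place_def bs)
  moreover have "concat (map (place (f # fs) bs) [Suc f..<M]) = concat bs'"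
  proof -
    have "map (place (f # fs) bs) [Suc f..<M] = map (place fs bs') [Suc f..<M]"
      by (intro map_cong refl) (auto simp: place_def bs)
    moreover have "concat (map (place fs bs') [Suc f..<M]) = concat bs'"
      using Cons.prems gt by (intro Cons.IH) (auto simp: bs)
    ultimately show ?thesis by (simp only:)
  qed
  ultimately show ?case
    by (simp only: bs map_append concat_append list.map concat.simps append_Nil)
qed

section \<open>Counting the grafting data\<close>

lemma sum_Pow_card:
  assumes "finite A"
  shows "(\<Sum>S \<in> Pow A. f (card S)) = (\<Sum>k \<le> card A. (card A choose k) * f k :: nat)"
proof -
  have "(\<Sum>S \<in> Pow A. f (card S)) = (\<Sum>k \<le> card A. \<Sum>S \<in> {S \<in> Pow A. card S = k}. f (card S))"
    using assms by (intro sum.group[symmetric]) (auto simp: card_mono)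
  also have "\<dots> = (\<Sum>k \<le> card A. card {S. S \<subseteq> A \<and> card S = k} * f k)"
    by (intro sum.cong refl) (simp add: Pow_def)
  finally show ?thesis by (simp add: n_subsets[OF assms])
qed

definition graft_index :: "nat \<Rightarrow> nat \<Rightarrow> (nat set \<times> nat set) set" where
  "graft_index m n = (SIGMA S : Pow {1..<n}. {F. F \<subseteq> {0..m} \<and> card F = card S + 1})"

text \<open>For \<open>k\<close> inner cuts there are \<open>k + 1\<close> blocks to be sent to
  \<open>m + 1\<close> nodes. Replacing \<open>Suc m choose (k + 1)\<close> by
  \<open>Suc m choose (m - k)\<close> brings the sum into Vandermonde form. The result is the number
  of shuffles of disjoint words of lengths \<open>m\<close> and \<open>n\<close>.\<close>

lemma card_graft_index:
  assumes "n > 0"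
  shows "card (graft_index m n) = (m + n) choose m"
proof -
  have "card (graft_index m n) = (\<Sum>S \<in> Pow {1..<n}. Suc m choose (card S + 1))"
    by (simp add: graft_index_def n_subsets)
  also have "\<dots> = (\<Sum>k \<le> n - 1. (n - 1 choose k) * (Suc m choose (k + 1)))"
    by (subst sum_Pow_card) simp_all
  \<comment> \<open>The range is first enlarged by terms with \<open>k > n - 1\<close>, where the
    first factor vanishes, and then cut down to \<open>k \<le> m\<close>, since the second factor
    vanishes beyond. This avoids comparing \<open>n - 1\<close> with \<open>m\<close>.\<close>
  also have "\<dots> = (\<Sum>k \<le> n - 1 + m. (n - 1 choose k) * (Suc m choose (k + 1)))"
    by (intro sum.mono_neutral_left) auto
  also have "\<dots> = (\<Sum>k \<le> m. (n - 1 choose k) * (Suc m choose (k + 1)))"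
    by (intro sum.mono_neutral_right) auto
  also have "\<dots> = (\<Sum>k \<le> m. (n - 1 choose k) * (Suc m choose (m - k)))"
  proof (intro sum.cong refl arg_cong2[where f = times])
    fix k assume "k \<in> {..m}"
    then have "Suc m - (k + 1) = m - k" "k + 1 \<le> Suc m" by auto
    then show "Suc m choose (k + 1) = Suc m choose (m - k)"
      using binomial_symmetric[of "k + 1" "Suc m"] by simp
  qed
  also have "\<dots> = (n - 1 + Suc m) choose m" by (rule vandermonde)
  finally show ?thesis using assms by (simp add: add.commute)
qed

section \<open>The bijection between grafting data and shuffles\<close>

context
  fixes t u :: rtree
  assumes dt: "distinct (postF t)" and du: "distinct (postF u)"
    and disj: "set (postF t) \<inter> set (postF u) = {}" and n: "deg u > 0"
begin

definition cuts :: "nat set \<Rightarrow> nat list" where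
  "cuts S = sorted_list_of_set ({0, deg u} \<union> S)"

definition block :: "nat set \<Rightarrow> nat set \<Rightarrow> nat \<Rightarrow> nat list" where
  "block S F = place (sorted_list_of_set F) (segments (postF u) (cuts S))"

lemma cuts_props:
  assumes "S \<subseteq> {1..<deg u}"
  shows "sorted (cuts S)" "distinct (cuts S)" "set (cuts S) = {0, deg u} \<union> S"
    "length (cuts S) = card S + 2" "\<exists>cs. cuts S = 0 # cs" "last (cuts S) = deg u"
proof -
  have fin: "finite S" using assms finite_subset by blast
  show 1: "sorted (cuts S)" and 2: "distinct (cuts S)" and 3: "set (cuts S) = {0, deg u} \<union> S"
    unfolding cuts_def using fin by (simp_all del: sorted_list_of_set_insert_remove)
  \<comment> \<open>Positive degree keeps the end points 0 and \<open>deg u\<close> apart, which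
    gives \<open>card S + 2\<close> cut points and thus \<open>card S + 1\<close> blocks, matching
    the size of \<open>F\<close>.\<close>
  have "0 \<notin> S" "deg u \<notin> S" using assms by auto
  then have "card ({0, deg u} \<union> S) = card S + 2" using fin n by simp
  then show "length (cuts S) = card S + 2" unfolding cuts_def by (simp del: sorted_list_of_set_insert_remove)
  have ne: "cuts S \<noteq> []" using 3 by auto
  then obtain c cs where c: "cuts S = c # cs" by (cases "cuts S") auto
  have "0 \<in> set (cuts S)" using 3 by simp
  then have "c = 0" using 1 c by auto
  then show "\<exists>cs. cuts S = 0 # cs" using c by simp
  obtain ds l where l: "cuts S = ds @ [l]" using ne by (cases "cuts S" rule: rev_cases) auto
  have "deg u \<in> set (cuts S)" using 3 by simp
  then have "deg u \<le> l" using 1 l by (auto simp: sorted_append)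
  moreover have "l \<in> {0, deg u} \<union> S" unfolding 3[symmetric] using l by simp
  ultimately have "l = deg u" using assms n by fastforce
  then show "last (cuts S) = deg u" using l by simp
qed

lemma block_concat:
  assumes "(S, F) \<in> graft_index (deg t) (deg u)"
  shows "concat (map (block S F) [0..<Suc (deg t)]) = postF u"
proof -
  have S: "S \<subseteq> {1..<deg u}" and F: "F \<subseteq> {0..deg t}" "card F = card S + 1"
    using assms by (auto simp: graft_index_def)
  have fin: "finite F" using F finite_subset by blast
  obtain cs where cs: "cuts S = 0 # cs" using cuts_props(5)[OF S] by blast
  have "concat (map (block S F) [0..<Suc (deg t)]) = concat (segments (postF u) (cuts S))"
    unfolding block_def
    using F fin cuts_props[OF S] by (intro concat_place) (auto simp: length_segments less_Suc_eq_le)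
  also have "\<dots> = postF u"
    using concat_segments[of 0 cs "postF u"] cuts_props[OF S] by (simp add: cs deg_def)
  finally show ?thesis .
qed

lemma graft_block:
  "block_graft t u (block S F) (deg t) \<Longrightarrow> graft t u S F = block_graft.r t u (block S F) (deg t)"
proof -
  assume B: "block_graft t u (block S F) (deg t)"
  \<comment> \<open>\<open>graft\<close> looks up forests where \<open>block\<close> looks up words.
    Restriction to the letters of a word passes from one to the other, also for the default, because
    restricting to the empty set gives the empty forest.\<close>
  have *: "(case map_of (zip fs (map (\<lambda>(i, j). interval_tree i j u) zs)) p of None \<Rightarrow> [] | Some f \<Rightarrow> f) =
      restrF (set (case map_of (zip fs (map (\<lambda>(i, j). drop i (take j (postF u))) zs)) p of
        None \<Rightarrow> [] | Some b \<Rightarrow> b)) u" for fs zs p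
    by (simp add: zip_map2 map_of_map interval_tree_def restrF_none split: option.split prod.split)
  show ?thesis
    unfolding graft_def Let_def block_graft.r_def[OF B] block_graft.h_def[OF B, abs_def] *
    unfolding block_def place_def segments_def cuts_def
    by (rule refl)
qed

lemma block_graftI: "(S, F) \<in> graft_index (deg t) (deg u) \<Longrightarrow> block_graft t u (block S F) (deg t)"
  using dt du disj block_concat by unfold_locales auto

lemma graft_props:
  assumes "(S, F) \<in> graft_index (deg t) (deg u)"
  defines "w \<equiv> postF (graft t u S F)"
  shows "w \<in> shuffles (postF t) (postF u)" "descF (graft t u S F) = glue_desc t u w"
    "graft t u S F = glue t u w"
proof -
  interpret block_graft t u "block S F" "deg t" using assms(1) by (rule block_graftI)
  have "graft t u S F = r" by (rule graft_block) (fact block_graft_axioms)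
  then show "w \<in> shuffles (postF t) (postF u)" "descF (graft t u S F) = glue_desc t u w"
    "graft t u S F = glue t u w"
    unfolding w_def using postF_r W_shuffle descF_r r_glue by simp_all
qed

text \<open>By \<open>B_eq_filter\<close> equal words have equal blocks in every slot. The occupied
  slots form \<open>F\<close>, and the sequence of their contents determines the cut points.\<close>

lemma graft_inj:
  assumes SF: "(S, F) \<in> graft_index (deg t) (deg u)" and SF': "(S', F') \<in> graft_index (deg t) (deg u)"
    and eq: "postF (graft t u S F) = postF (graft t u S' F')"
  shows "S = S' \<and> F = F'"
proof -
  interpret A: block_graft t u "block S F" "deg t" using SF by (rule block_graftI)
  interpret B: block_graft t u "block S' F'" "deg t" using SF' by (rule block_graftI)
  have "graft t u S F = A.r" by (rule graft_block) (fact A.block_graft_axioms)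
  moreover have "graft t u S' F' = B.r" by (rule graft_block) (fact B.block_graft_axioms)
  ultimately have W: "A.W = B.W" using eq A.postF_r B.postF_r by simp
  have blk: "block S F p = block S' F' p" if "p \<le> deg t" for p
    using A.B_eq_filter[OF that] B.B_eq_filter[OF that] W by simp
  have props: "S \<subseteq> {1..<deg u}" "F \<subseteq> {0..deg t}" "card F = card S + 1"
     "S' \<subseteq> {1..<deg u}" "F' \<subseteq> {0..deg t}" "card F' = card S' + 1"
    using SF SF' by (auto simp: graft_index_def)
  have F: "F = {p. p \<le> deg t \<and> block S F p \<noteq> []}"
    and seg: "segments (postF u) (cuts S) = map (block S F) (sorted_list_of_set F)"
    if S: "S \<subseteq> {1..<deg u}" and F: "F \<subseteq> {0..deg t}" "card F = card S + 1" for S F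
  proof -
    have fin: "finite F" using F finite_subset by blast
    have len: "length (sorted_list_of_set F) = length (segments (postF u) (cuts S))"
      using cuts_props(4)[OF S] F by (simp add: length_segments)
    show seg: "segments (postF u) (cuts S) = map (block S F) (sorted_list_of_set F)"
      unfolding block_def using map_place[OF len] by simp
    \<comment> \<open>The cut points increase strictly, so no block is empty and an occupied slot
      can be told from a free one.\<close>
    have "[] \<notin> set (segments (postF u) (cuts S))"
      using cuts_props[OF S] S by (intro segments_nonempty) (auto simp: deg_def)
    then have "\<forall>p \<in> F. block S F p \<noteq> []" using fin unfolding seg by force
    moreover have "block S F p = []" if "p \<notin> F" for p
      unfolding block_def using that fin by (intro place_notin) simp
    ultimately show "F = {p. p \<le> deg t \<and> block S F p \<noteq> []}" using F by auto
  qed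
  have FF: "F = F'"
  proof -
    have "F = {p. p \<le> deg t \<and> block S F p \<noteq> []}" by (rule F[OF props(1-3)])
    also have "\<dots> = {p. p \<le> deg t \<and> block S' F' p \<noteq> []}" using blk by auto
    also have "\<dots> = F'" by (rule F[OF props(4-6), symmetric])
    finally show ?thesis .
  qed
  have "segments (postF u) (cuts S) = segments (postF u) (cuts S')"
    unfolding seg[OF props(1-3)] seg[OF props(4-6)] FF
    using props(5) finite_subset[OF props(5)] blk FF by auto
  moreover obtain cs where cs: "cuts S = 0 # cs" using cuts_props(5)[OF props(1)] by blast
  moreover obtain cs' where cs': "cuts S' = 0 # cs'" using cuts_props(5)[OF props(4)] by blast
  moreover have "\<forall>i \<in> set cs \<union> set cs'. i \<le> length (postF u)"
  proof
    fix i assume "i \<in> set cs \<union> set cs'"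
    then have "i \<in> set (cuts S) \<union> set (cuts S')" using cs cs' by auto
    then show "i \<le> length (postF u)"
      using cuts_props(3)[OF props(1)] cuts_props(3)[OF props(4)] props(1,4) by (auto simp: deg_def)
  qed
  ultimately have "cs = cs'"
    using segments_inj[of "postF u" 0 cs cs'] cuts_props(1)[OF props(1)] cuts_props(1)[OF props(4)] by simp
  then have "{0, deg u} \<union> S = {0, deg u} \<union> S'"
    using cuts_props(3)[OF props(1)] cuts_props(3)[OF props(4)] cs cs' by simp
  moreover have "S = ({0, deg u} \<union> S) - {0, deg u}" "S' = ({0, deg u} \<union> S') - {0, deg u}"
    using props(1,4) by auto
  ultimately have "S = S'" by metis
  then show ?thesis using FF by simp
qed

text \<open>An injective map into a finite set with the same number of elements is onto; no preimage
  of a shuffle is exhibited.\<close>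

lemma graft_bij:
  "bij_betw (\<lambda>(S, F). postF (graft t u S F)) (graft_index (deg t) (deg u)) (shuffles (postF t) (postF u))"
proof -
  let ?f = "\<lambda>(S, F). postF (graft t u S F)"
  have inj: "inj_on ?f (graft_index (deg t) (deg u))"
    using graft_inj by (auto simp: inj_on_def)
  have "?f ` graft_index (deg t) (deg u) = shuffles (postF t) (postF u)"
  proof (rule card_subset_eq)
    show "?f ` graft_index (deg t) (deg u) \<subseteq> shuffles (postF t) (postF u)"
      using graft_props(1) by auto
    show "card (?f ` graft_index (deg t) (deg u)) = card (shuffles (postF t) (postF u))"
      using card_image[OF inj] card_graft_index[OF n] card_disjoint_shuffles[OF disj]
      by (simp add: deg_def)
  qed simp
  then show ?thesis using inj by (simp add: bij_betw_def)
qed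

end

lemma glue_Nil: "distinct (postF t) \<Longrightarrow> descF t = glue_desc t [] (postF t)"
  using descF_bef[of t] by (auto simp: glue_desc_def)

text \<open>Existence of the chosen forest: every shuffle is the word of some graft. The empty
  \<open>u\<close> is handled apart, since the bijection requires positive degree; there the only
  shuffle is the word of \<open>t\<close>, realised by \<open>t\<close> itself.\<close>

lemma glue_props:
  assumes "distinct (postF t)" "distinct (postF u)" "set (postF t) \<inter> set (postF u) = {}"
    "w \<in> shuffles (postF t) (postF u)"
  shows "postF (glue t u w) = w" "descF (glue t u w) = glue_desc t u w"
proof -
  have dw: "distinct w" using distinct_disjoint_shuffles assms by blast
  have "\<exists>r. postF r = w \<and> descF r = glue_desc t u w"
  proof (cases "u = []")
    case True
    then show ?thesis using assms glue_Nil by auto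
  next
    case False
    then have n: "deg u > 0" by (simp add: deg_def)
    obtain S F where "(S, F) \<in> graft_index (deg t) (deg u)" "w = postF (graft t u S F)"
      using graft_bij[OF assms(1-3) n] assms(4) by (fastforce simp: bij_betw_def)
    then show ?thesis using graft_props(2)[OF assms(1-3) n] by blast
  qed
  then show "postF (glue t u w) = w" "descF (glue t u w) = glue_desc t u w"
    using glueI[OF dw] by metis+
qed

theorem graft_sum_shuffles:
  assumes "distinct (postF t)" "distinct (postF u)" "set (postF t) \<inter> set (postF u) = {}"
  shows "graft_sum t u = (\<Sum>w \<in> shuffles (postF t) (postF u). basis (Abs_ntree (glue t u w)))"
proof (cases "u = []")
  case True
  then show ?thesis
    using glueI[OF assms(1) refl glue_Nil[OF assms(1)]] by (simp add: graft_sum_def deg_def)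
next
  case False
  then have n: "deg u > 0" by (simp add: deg_def)
  have "graft_sum t u = (\<Sum>(S, F) \<in> graft_index (deg t) (deg u). basis (Abs_ntree (graft t u S F)))"
    using n unfolding graft_sum_def graft_index_def by (simp add: sum.Sigma)
  also have "\<dots> = (\<Sum>(S, F) \<in> graft_index (deg t) (deg u).
      basis (Abs_ntree (glue t u (postF (graft t u S F)))))"
    using graft_props(3)[OF assms n] by (intro sum.cong) auto
  also have "\<dots> = (\<Sum>w \<in> shuffles (postF t) (postF u). basis (Abs_ntree (glue t u w)))"
    by (subst sum.reindex_bij_betw[OF graft_bij[OF assms n], symmetric])
      (simp add: case_prod_unfold)
  finally show ?thesis .
qed

section \<open>Gluing under relabelling, restriction and iteration\<close>

lemma in_map_prod_image:
  assumes "inj_on g A" "R \<subseteq> A \<times> A" "y \<in> A" "x \<in> A"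
  shows "(g y, g x) \<in> map_prod g g ` R \<longleftrightarrow> (y, x) \<in> R"
proof
  assume "(g y, g x) \<in> map_prod g g ` R"
  then obtain y' x' where *: "(y', x') \<in> R" "g y = g y'" "g x = g x'" by auto
  then have "y' \<in> A" "x' \<in> A" using assms(2) by auto
  then show "(y, x) \<in> R" using * assms(1,3,4) by (simp add: inj_on_eq_iff)
qed force

lemma map_shuffles: "shuffles (map g xs) (map g ys) = map g ` shuffles xs ys"
  by (induction xs ys rule: shuffles.induct) (simp_all add: image_Un image_image)

lemma glue_desc_subset: "glue_desc t u w \<subseteq> set w \<times> set w"
  using bef_subset by (fastforce simp: glue_desc_def)

text \<open>The formula refers to membership, order in the word and the two relations, never to the
  size of labels, so any injection transports it. Monotonicity matters only for
  standardization.\<close>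

lemma glue_desc_relabelF:
  assumes inj: "inj_on g (set w)" and w: "set w = set (postF t) \<union> set (postF u)"
  shows "glue_desc (relabelF g t) (relabelF g u) (map g w) = map_prod g g ` glue_desc t u w"
proof -
  let ?L = "glue_desc (relabelF g t) (relabelF g u) (map g w)"
  have sub: "set (postF t) \<subseteq> set w" "set (postF u) \<subseteq> set w" using w by auto
  have d: "descF t \<subseteq> set w \<times> set w" "descF u \<subseteq> set w \<times> set w"
    using descF_subset[of t] descF_subset[of u] w by auto
  have mem: "(g y, g x) \<in> ?L \<longleftrightarrow> (y, x) \<in> glue_desc t u w" if "y \<in> set w" "x \<in> set w" for y x
  proof -
    have i: "g a \<in> g ` B \<longleftrightarrow> a \<in> B" if "a \<in> set w" "B \<subseteq> set w" for a B
      using inj_on_image_mem_iff[OF inj that] .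
    have z: "z \<in> set w" if "z \<in> set (postF t)" for z using that sub by blast
    show ?thesis
      unfolding glue_desc_def descF_relabelF bef_map postF_relabelF set_map
      using that z
      by (simp add: in_map_prod_image[OF inj] d bef_subset i sub)
  qed
  show ?thesis
  proof (intro equalityI subrelI)
    fix y' x' assume L: "(y', x') \<in> ?L"
    then have "y' \<in> g ` set w" "x' \<in> g ` set w" using glue_desc_subset by fastforce+
    then obtain y x where "y \<in> set w" "x \<in> set w" "y' = g y" "x' = g x" by blast
    then show "(y', x') \<in> map_prod g g ` glue_desc t u w" using L mem by auto
  next
    fix y' x' assume "(y', x') \<in> map_prod g g ` glue_desc t u w"
    then obtain y x where yx: "(y, x) \<in> glue_desc t u w" "y' = g y" "x' = g x" by auto
    then have "y \<in> set w" "x \<in> set w" using glue_desc_subset by fastforce+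
    then show "(y', x') \<in> ?L" using yx mem by simp
  qed
qed

lemma glue_relabelF:
  assumes t: "distinct (postF t)" "distinct (postF u)" "set (postF t) \<inter> set (postF u) = {}"
    and w: "w \<in> shuffles (postF t) (postF u)" and inj: "inj_on g (set (postF t) \<union> set (postF u))"
  shows "glue (relabelF g t) (relabelF g u) (map g w) = relabelF g (glue t u w)"
proof (rule glueI)
  have s: "set w = set (postF t) \<union> set (postF u)" using w by (rule set_shuffles)
  show "distinct (map g w)"
    using distinct_disjoint_shuffles[OF t w] inj s by (simp add: distinct_map)
  show "postF (relabelF g (glue t u w)) = map g w" by (simp add: glue_props[OF t w])
  show "descF (relabelF g (glue t u w)) = glue_desc (relabelF g t) (relabelF g u) (map g w)"
    using inj s by (simp add: descF_relabelF glue_props[OF t w] glue_desc_relabelF)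
qed

text \<open>The formula quantifies over letters of \<open>t\<close> standing between
  \<open>y\<close> and \<open>x\<close>. If \<open>A\<close> is convex in \<open>w\<close>, all of
  these survive the restriction, so no separating letter gets lost.\<close>

lemma glue_restrF:
  assumes t: "distinct (postF t)" "distinct (postF u)" "set (postF t) \<inter> set (postF u) = {}"
    and w: "w \<in> shuffles (postF t) (postF u)"
    and conv: "\<And>x y z. \<lbrakk>y \<in> A; x \<in> A; (y, z) \<in> bef w; (z, x) \<in> bef w\<rbrakk> \<Longrightarrow> z \<in> A"
  shows "restrF A (glue t u w) = glue (restrF A t) (restrF A u) (filter (\<lambda>a. a \<in> A) w)"
proof (rule glueI[symmetric])
  show "distinct (filter (\<lambda>a. a \<in> A) w)"
    using distinct_disjoint_shuffles[OF t w] by simp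
  show "postF (restrF A (glue t u w)) = filter (\<lambda>a. a \<in> A) w" by (simp add: glue_props[OF t w])
  have "(y, x) \<in> glue_desc t u w \<and> y \<in> A \<and> x \<in> A \<longleftrightarrow>
      (y, x) \<in> glue_desc (restrF A t) (restrF A u) (filter (\<lambda>a. a \<in> A) w)" for y x
    unfolding glue_desc_def descF_restrF postF_restrF bef_filter
    using conv[of y x] by auto
  then show "descF (restrF A (glue t u w)) =
      glue_desc (restrF A t) (restrF A u) (filter (\<lambda>a. a \<in> A) w)"
    by (auto simp: descF_restrF glue_props[OF t w])
qed

text \<open>Both forests have the word \<open>w\<close>, so only their descendant relations have to
  be compared.\<close>

lemma glue_assoc:
  assumes d: "distinct (postF t)" "distinct (postF u)" "distinct (postF v)"
    and disj: "set (postF t) \<inter> set (postF u) = {}" "set (postF t) \<inter> set (postF v) = {}"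
      "set (postF u) \<inter> set (postF v) = {}"
    and w12: "w12 \<in> shuffles (postF t) (postF u)" and w: "w \<in> shuffles w12 (postF v)"
    and w23: "w23 \<in> shuffles (postF u) (postF v)" and w': "w \<in> shuffles (postF t) w23"
  shows "glue (glue t u w12) v w = glue t (glue u v w23) w"
proof -
  note g12 = glue_props[OF d(1,2) disj(1) w12]
  note g23 = glue_props[OF d(2,3) disj(3) w23]
  have s12: "set w12 = set (postF t) \<union> set (postF u)" using w12 by (rule set_shuffles)
  have s23: "set w23 = set (postF u) \<union> set (postF v)" using w23 by (rule set_shuffles)
  have d12: "distinct w12" using distinct_disjoint_shuffles d disj w12 by blast
  have d23: "distinct w23" using distinct_disjoint_shuffles d disj w23 by blast
  have j12: "set w12 \<inter> set (postF v) = {}" using s12 disj by auto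
  have j23: "set (postF t) \<inter> set w23 = {}" using s23 disj by auto
  have dw: "distinct w" using distinct_disjoint_shuffles[OF d12 d(3) j12 w] .
  \<comment> \<open>The intermediate words inherit their order from \<open>w\<close>, so both sides
    can be written with \<open>bef w\<close> alone.\<close>
  have "w12 = filter (\<lambda>x. x \<in> set w12) w" using w in_shuffles_iff[OF j12] by simp
  then have b12: "bef w12 = bef w \<inter> set w12 \<times> set w12" using bef_filter[of "\<lambda>x. x \<in> set w12" w] by simp
  have "w23 = filter (\<lambda>x. x \<in> set w23) w" using w' in_shuffles_iff[OF j23] by simp
  then have b23: "bef w23 = bef w \<inter> set w23 \<times> set w23" using bef_filter[of "\<lambda>x. x \<in> set w23" w] by simp
  note R = glue_props[of t "glue u v w23" w, unfolded g23, OF d(1) d23 j23 w']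
  have "(y, x) \<in> glue_desc (glue t u w12) v w \<longleftrightarrow> (y, x) \<in> glue_desc t (glue u v w23) w" for y x
  proof (cases "(y, x) \<in> bef w")
    case True
    have x: "x \<in> set (postF t) \<or> x \<in> set (postF u) \<or> x \<in> set (postF v)"
      and y: "y \<in> set (postF t) \<or> y \<in> set (postF u) \<or> y \<in> set (postF v)"
      using befD[OF True] set_shuffles[OF w] s12 by auto
    have dt: "(b, c) \<in> descF t \<longleftrightarrow> (b, c) \<in> descF t \<and> b \<in> set (postF t) \<and> c \<in> set (postF t)"
      and duu: "(b, c) \<in> descF u \<longleftrightarrow> (b, c) \<in> descF u \<and> b \<in> set (postF u) \<and> c \<in> set (postF u)"
      and dv: "(b, c) \<in> descF v \<longleftrightarrow> (b, c) \<in> descF v \<and> b \<in> set (postF v) \<and> c \<in> set (postF v)" for b c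
      using descF_subset by blast+
    have tr: "(a, c) \<in> bef w" if "(a, b) \<in> bef w" "(b, c) \<in> bef w" for a b c
      using bef_trans[OF dw that] .
    have sh: "a \<notin> set (postF u) \<and> a \<notin> set (postF v)" if "a \<in> set (postF t)" for a using that disj by blast
    have sh2: "a \<notin> set (postF v)" if "a \<in> set (postF u)" for a using that disj by blast
    have e1: "(y, x) \<in> glue_desc (glue t u w12) v w \<longleftrightarrow>
      (y, x) \<in> glue_desc t u w12 \<or>
      (x \<in> set (postF t) \<or> x \<in> set (postF u)) \<and> y \<in> set (postF v) \<and>
       (\<forall>z \<in> set (postF t) \<union> set (postF u). (y, z) \<in> bef w \<longrightarrow> (z, x) \<in> bef w \<longrightarrow> (z, x) \<in> glue_desc t u w12) \<or>
      (y, x) \<in> descF v \<and> (\<forall>z \<in> set (postF t) \<union> set (postF u). (y, z) \<in> bef w \<longrightarrow> (z, x) \<notin> bef w)"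
      using True by (simp add: glue_desc_def[of "glue t u w12"] g12 s12)
    have e2: "(y, x) \<in> glue_desc t (glue u v w23) w \<longleftrightarrow>
      (y, x) \<in> descF t \<or>
      x \<in> set (postF t) \<and> (y \<in> set (postF u) \<or> y \<in> set (postF v)) \<and>
       (\<forall>z \<in> set (postF t). (y, z) \<in> bef w \<longrightarrow> (z, x) \<in> bef w \<longrightarrow> (z, x) \<in> descF t) \<or>
      (y, x) \<in> glue_desc u v w23 \<and> (\<forall>z \<in> set (postF t). (y, z) \<in> bef w \<longrightarrow> (z, x) \<notin> bef w)"
      using True by (simp add: glue_desc_def[of t "glue u v w23"] g23 s23)
    have e3: "(z, x) \<in> glue_desc t u w12 \<longleftrightarrow> (z, x) \<in> bef w \<and> ((z, x) \<in> descF t \<or>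
      x \<in> set (postF t) \<and> z \<in> set (postF u) \<and>
       (\<forall>z' \<in> set (postF t). (z, z') \<in> bef w \<longrightarrow> (z', x) \<in> bef w \<longrightarrow> (z', x) \<in> descF t) \<or>
      (z, x) \<in> descF u \<and> (\<forall>z' \<in> set (postF t). (z, z') \<in> bef w \<longrightarrow> (z', x) \<notin> bef w))" for z
      unfolding glue_desc_def b12 s12 using dt[of z x] duu[of z x] by auto
    have e4: "(y, x) \<in> glue_desc u v w23 \<longleftrightarrow> (y, x) \<in> descF u \<or>
      x \<in> set (postF u) \<and> y \<in> set (postF v) \<and>
       (\<forall>z' \<in> set (postF u). (y, z') \<in> bef w \<longrightarrow> (z', x) \<in> bef w \<longrightarrow> (z', x) \<in> descF u) \<or>
      (y, x) \<in> descF v \<and> (\<forall>z' \<in> set (postF u). (y, z') \<in> bef w \<longrightarrow> (z', x) \<notin> bef w)"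
      unfolding glue_desc_def b23 s23 using True dv[of y x] duu[of y x] by auto
    have o: "a \<notin> set (postF t) \<Longrightarrow> (a, x) \<notin> descF t" "a \<notin> set (postF u) \<Longrightarrow> (a, x) \<notin> descF u"
      "a \<notin> set (postF v) \<Longrightarrow> (a, x) \<notin> descF v" for a
      using dt duu dv by blast+
    \<comment> \<open>Each letter comes from exactly one of the three trees, which leaves nine pairs
      of origins. Transitivity of the order enters only when \<open>y\<close> comes from
      \<open>v\<close> and \<open>x\<close> from \<open>t\<close> or \<open>u\<close>.\<close>
    consider (y1) "y \<in> set (postF t)" "y \<notin> set (postF u)" "y \<notin> set (postF v)"
      | (y2) "y \<notin> set (postF t)" "y \<in> set (postF u)" "y \<notin> set (postF v)"
      | (y3) "y \<notin> set (postF t)" "y \<notin> set (postF u)" "y \<in> set (postF v)"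
      using y sh sh2 by blast
    note yc = this
    consider (t) "x \<in> set (postF t)" "x \<notin> set (postF u)" "x \<notin> set (postF v)"
      | (u) "x \<notin> set (postF t)" "x \<in> set (postF u)" "x \<notin> set (postF v)"
      | (v) "x \<notin> set (postF t)" "x \<notin> set (postF u)" "x \<in> set (postF v)"
      using x sh sh2 by blast
    then show ?thesis
    proof cases
      case t
      have n: "(z, x) \<notin> descF u" "(z, x) \<notin> descF v" for z using t dt duu dv by blast+
      show ?thesis
      proof (cases rule: yc)
        case y1
        show ?thesis unfolding e1 e2 e3 e4 by (simp add: t y1 n True o)
      next
        case y2
        show ?thesis unfolding e1 e2 e3 e4 by (simp add: t y2 n True o)
      next
        case y3
        \<comment> \<open>The left side imposes a further condition on letters \<open>z\<close> of
          \<open>u\<close> between \<open>y\<close> and \<open>x\<close>. It follows from the right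
          side, because a letter of \<open>t\<close> between \<open>z\<close> and \<open>x\<close>
          also stands between \<open>y\<close> and \<open>x\<close>.\<close>
        show ?thesis unfolding e1 e2 e3 e4 by (simp add: t y3 n True o) (use tr[of y] sh in blast)
      qed
    next
      case u
      have n: "(z, x) \<notin> descF t" "(z, x) \<notin> descF v" for z using u dt duu dv by blast+
      show ?thesis
      proof (cases rule: yc)
        case y1
        show ?thesis unfolding e1 e2 e3 e4 by (simp add: u y1 n True o)
      next
        case y2
        show ?thesis unfolding e1 e2 e3 e4 by (simp add: u y2 n True o)
      next
        case y3
        \<comment> \<open>No letter of \<open>t\<close> lies below a letter of \<open>u\<close>, so
          the condition on the left forbids letters of \<open>t\<close> between \<open>y\<close> and
          \<open>x\<close>, as the right side does explicitly.\<close>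
        have "(z, x) \<notin> descF u" if "z \<in> set (postF t)" for z using o(2) sh[OF that] by blast
        then show ?thesis unfolding e1 e2 e3 e4 by (simp add: u y3 n True o) (use tr[of y] in blast)
      qed
    next
      case v
      have n: "(z, x) \<notin> descF t" "(z, x) \<notin> descF u" for z using v dt duu dv by blast+
      show ?thesis
      proof (cases rule: yc)
        case y1
        show ?thesis unfolding e1 e2 e3 e4 by (simp add: v y1 n True o)
      next
        case y2
        show ?thesis unfolding e1 e2 e3 e4 by (simp add: v y2 n True o)
      next
        case y3
        show ?thesis unfolding e1 e2 e3 e4 by (simp add: v y3 n True o) blast
      qed
    qed
  next
    case False
    then show ?thesis by (simp add: glue_desc_def)
  qed
  then have "descF (glue t (glue u v w23) w) = glue_desc (glue t u w12) v w"
    using R by auto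
  then show ?thesis using glueI[OF dw R(1)] by simp
qed

subsection \<open>Linear extensions\<close>

lemma lookup_cmul [simp]: "Poly_Mapping.lookup (cmul c x) a = c * Poly_Mapping.lookup x a"
  by (simp add: cmul_def Poly_Mapping.map.rep_eq when_def)

lemma cmul_simps [simp]:
  "cmul 0 x = 0" "cmul c 0 = 0" "cmul 1 x = x" "cmul c (cmul d x) = cmul (c * d) x"
  by (rule poly_mapping_eqI, simp add: mult.assoc)+

lemma cmul_add: "cmul c (x + y) = cmul c x + cmul c y"
  by (rule poly_mapping_eqI) (simp add: lookup_add algebra_simps)

lemma cmul_add_left: "cmul (c + d) x = cmul c x + cmul d x"
  by (rule poly_mapping_eqI) (simp add: lookup_add algebra_simps)

lemma cmul_diff: "cmul c (x - y) = cmul c x - cmul c y"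
  by (rule poly_mapping_eqI) (simp add: lookup_minus algebra_simps)

lemma cmul_sum: "cmul c (\<Sum>i \<in> I. f i) = (\<Sum>i \<in> I. cmul c (f i))"
  by (induction I rule: infinite_finite_induct) (simp_all add: cmul_add)

lemma cmul_sum_left: "cmul (\<Sum>i \<in> I. c i) x = (\<Sum>i \<in> I. cmul (c i) x)"
  by (induction I rule: infinite_finite_induct) (simp_all add: cmul_add_left)

text \<open>Sums over the keys of different arguments become comparable over a common finite index
  set; the added terms have coefficient zero.\<close>

lemma lext_superset:
  assumes "finite A" "Poly_Mapping.keys x \<subseteq> A"
  shows "lext f x = (\<Sum>a \<in> A. cmul (Poly_Mapping.lookup x a) (f a))"
  unfolding lext_def using assms by (intro sum.mono_neutral_left) (auto simp: in_keys_iff)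

lemma lext_cong: "(\<And>a. a \<in> Poly_Mapping.keys x \<Longrightarrow> f a = g a) \<Longrightarrow> lext f x = lext g x"
  unfolding lext_def by (intro sum.cong) auto

lemma lext_zero [simp]: "lext f 0 = 0"
  by (simp add: lext_def)

lemma lext_fun_zero [simp]: "lext (\<lambda>_. 0) x = 0"
  by (simp add: lext_def)

lemma lext_add: "lext f (x + y) = lext f x + lext f y"
proof -
  let ?A = "Poly_Mapping.keys x \<union> Poly_Mapping.keys y"
  have "lext f (x + y) = (\<Sum>a \<in> ?A. cmul (Poly_Mapping.lookup (x + y) a) (f a))"
    by (intro lext_superset) (auto simp: in_keys_iff lookup_add)
  also have "\<dots> = lext f x + lext f y"
    by (subst (1 2) lext_superset[of ?A]) (auto simp: lookup_add cmul_add_left sum.distrib)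
  finally show ?thesis .
qed

lemma lext_cmul: "lext f (cmul c x) = cmul c (lext f x)"
proof -
  have "lext f (cmul c x) = (\<Sum>a \<in> Poly_Mapping.keys x. cmul (c * Poly_Mapping.lookup x a) (f a))"
    by (subst lext_superset[of "Poly_Mapping.keys x"]) (auto simp: in_keys_iff)
  also have "\<dots> = cmul c (lext f x)" by (simp add: lext_def cmul_sum)
  finally show ?thesis .
qed

lemma lext_diff: "lext f (x - y) = lext f x - lext f y"
  using lext_add[of f "x - y" y] by (simp add: algebra_simps)

lemma lext_sum: "lext f (\<Sum>i \<in> I. g i) = (\<Sum>i \<in> I. lext f (g i))"
  by (induction I rule: infinite_finite_induct) (simp_all add: lext_add)

lemma lext_basis [simp]: "lext f (basis a) = f a"
  by (simp add: lext_def basis_def)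

lemma lext_sum_basis: "lext f (\<Sum>i \<in> I. basis (g i)) = (\<Sum>i \<in> I. f (g i))"
  by (simp add: lext_sum)

lemma lext_fun_add: "lext (\<lambda>a. f a + g a) x = lext f x + lext g x"
  by (simp add: lext_def cmul_add sum.distrib)

lemma lext_fun_diff: "lext (\<lambda>a. f a - g a) x = lext f x - lext g x"
  by (simp add: lext_def cmul_diff sum_subtractf)

lemma lext_fun_cmul: "lext (\<lambda>a. cmul c (f a)) x = cmul c (lext f x)"
  by (simp add: lext_def cmul_sum mult.commute)

lemma lext_comp: "lext g (lext f x) = lext (\<lambda>a. lext g (f a)) x"
  by (simp add: lext_def[of f] lext_def[of "\<lambda>a. lext g (f a)"] lext_sum lext_cmul)

lemma lext_swap: "lext (\<lambda>a. lext (\<lambda>b. f a b) y) x = lext (\<lambda>b. lext (\<lambda>a. f a b) x) y"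
  unfolding lext_def cmul_sum by (subst sum.swap) (simp add: mult.commute)

lemma lext_basis_id: "lext basis x = x"
proof (rule poly_mapping_eqI)
  fix b
  have "Poly_Mapping.lookup (\<Sum>a \<in> A. cmul (Poly_Mapping.lookup x a) (basis a)) b =
      (\<Sum>a \<in> A. if a = b then Poly_Mapping.lookup x a else 0)" for A
    by (auto simp: Poly_Mapping.lookup_sum basis_def lookup_single when_def intro!: sum.cong)
  then show "Poly_Mapping.lookup (lext basis x) b = Poly_Mapping.lookup x b"
    by (simp add: lext_def in_keys_iff)
qed

lemma blext_lext_left: "blext f (lext g x) y = lext (\<lambda>a. blext f (g a) y) x"
  by (simp add: blext_def lext_comp)

lemma blext_lext_right: "blext f x (lext g y) = lext (\<lambda>b. blext f x (g b)) y"
  unfolding blext_def lext_comp by (rule lext_swap)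

lemma blext_add_left: "blext f (x + x') y = blext f x y + blext f x' y"
  by (simp add: blext_def lext_add)

lemma blext_add_right: "blext f x (y + y') = blext f x y + blext f x y'"
  by (simp add: blext_def lext_add lext_fun_add)

lemma blext_diff_left: "blext f (x - x') y = blext f x y - blext f x' y"
  by (simp add: blext_def lext_diff)

lemma blext_diff_right: "blext f x (y - y') = blext f x y - blext f x y'"
  by (simp add: blext_def lext_diff lext_fun_diff)

lemma blext_cmul_left: "blext f (cmul c x) y = cmul c (blext f x y)"
  by (simp add: blext_def lext_cmul)

lemma blext_cmul_right: "blext f x (cmul c y) = cmul c (blext f x y)"
  by (simp add: blext_def lext_cmul lext_fun_cmul)

lemma blext_zero [simp]: "blext f 0 y = 0" "blext f x 0 = 0"
  by (simp_all add: blext_def)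

lemma blext_basis [simp]: "blext f (basis a) (basis b) = f a b"
  by (simp add: blext_def)

lemma blext_sum_basis:
  "blext f (\<Sum>i \<in> I. basis (g i)) (\<Sum>j \<in> J. basis (h j)) = (\<Sum>i \<in> I. \<Sum>j \<in> J. f (g i) (h j))"
  by (simp add: blext_def lext_sum)

subsection \<open>Connected graded bialgebras are Hopf algebras\<close>

text \<open>All axioms are required on basis elements only. Connectedness is \<open>dg_0\<close>:
  the degree zero part is spanned by \<open>e\<close>, and \<open>eps\<close> is the coefficient of
  \<open>e\<close>.\<close>

locale connected_graded_bialgebra =
  fixes mb :: "'b \<Rightarrow> 'b \<Rightarrow> ('b \<Rightarrow>\<^sub>0 'k::field)" and e :: 'b
    and db :: "'b \<Rightarrow> ('b \<times> 'b \<Rightarrow>\<^sub>0 'k)" and eps :: "'b \<Rightarrow> 'k" and dg :: "'b \<Rightarrow> nat"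
  assumes assoc_basis: "lext (\<lambda>p. mb p c) (mb a b) = lext (mb a) (mb b c)"
    and unit_basis: "mb e a = basis a" "mb a e = basis a"
    and coassoc_basis:
      "lext (\<lambda>(a, b). lext (\<lambda>(c, c'). basis (c, c', b)) (db a)) (db x) =
       lext (\<lambda>(a, b). lext (\<lambda>(c, c'). basis (a, c, c')) (db b)) (db x)"
    and counit_basis: "lext (\<lambda>(a, b). cmul (eps a) (basis b)) (db x) = basis x"
      "lext (\<lambda>(a, b). cmul (eps b) (basis a)) (db x) = basis x"
    and mult_basis: "lext db (mb a b) =
      blext (\<lambda>(a, b) (a', b'). tens (mb a a') (mb b b')) (db a) (db b)"
    and db_e: "db e = basis (e, e)"
    and eps: "eps a = (if a = e then 1 else 0)"
    and dg_0: "dg a = 0 \<longleftrightarrow> a = e"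
    and dg_mb: "c \<in> Poly_Mapping.keys (mb a b) \<Longrightarrow> dg c = dg a + dg b"
    and dg_db: "(b, c) \<in> Poly_Mapping.keys (db a) \<Longrightarrow> dg b + dg c = dg a"
begin

abbreviation m :: "('b \<Rightarrow>\<^sub>0 'k) \<Rightarrow> ('b \<Rightarrow>\<^sub>0 'k) \<Rightarrow> ('b \<Rightarrow>\<^sub>0 'k)" where "m \<equiv> blext mb"

lemma m_assoc: "m (m x y) z = m x (m y z)"
proof -
  have "m (m x y) z = lext (\<lambda>a. lext (\<lambda>b. lext (\<lambda>c. lext (\<lambda>p. mb p c) (mb a b)) z) y) x"
    unfolding blext_def lext_comp by (subst lext_swap) (rule refl)
  also have "\<dots> = m x (m y z)"
    unfolding blext_def lext_comp assoc_basis ..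
  finally show ?thesis .
qed

lemma m_unit: "m (basis e) x = x" "m x (basis e) = x"
proof -
  have "mb e = basis" using unit_basis by blast
  then show "m (basis e) x = x" by (simp add: blext_def lext_basis_id)
  show "m x (basis e) = x" by (simp add: blext_def unit_basis lext_basis_id)
qed

definition unit_fun :: "'b \<Rightarrow> ('b \<Rightarrow>\<^sub>0 'k)" where
  "unit_fun a = cmul (eps a) (basis e)"

text \<open>The convolution product of two linear maps given on the basis. Its identity is
  \<open>unit_fun\<close>, and an antipode is a two-sided inverse of \<open>basis\<close>, which
  represents the identity map.\<close>

definition conv :: "('b \<Rightarrow> ('b \<Rightarrow>\<^sub>0 'k)) \<Rightarrow> ('b \<Rightarrow> ('b \<Rightarrow>\<^sub>0 'k)) \<Rightarrow> 'b \<Rightarrow> ('b \<Rightarrow>\<^sub>0 'k)" where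
  "conv f g a = lext (\<lambda>(b, c). m (f b) (g c)) (db a)"

lemma conv_cong:
  assumes "\<And>b c. (b, c) \<in> Poly_Mapping.keys (db a) \<Longrightarrow> m (f b) (g c) = m (f' b) (g' c)"
  shows "conv f g a = conv f' g' a"
  unfolding conv_def by (rule lext_cong) (use assms in auto)

lemma conv_assoc: "conv (conv f g) h = conv f (conv g h)"
proof
  fix a
  let ?\<Phi> = "\<lambda>(p, q, c). m (m (f p) (g q)) (h c)"
  have "conv (conv f g) h a = lext ?\<Phi> (lext (\<lambda>(a, b). lext (\<lambda>(c, c'). basis (c, c', b)) (db a)) (db a))"
    unfolding lext_comp
    by (simp add: conv_def case_prod_unfold blext_lext_left lext_comp)
  also have "\<dots> = lext ?\<Phi> (lext (\<lambda>(a, b). lext (\<lambda>(c, c'). basis (a, c, c')) (db b)) (db a))"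
    by (simp only: coassoc_basis)
  also have "\<dots> = conv f (conv g h) a"
    unfolding lext_comp
    by (simp add: conv_def case_prod_unfold blext_lext_right lext_comp m_assoc)
  finally show "conv (conv f g) h a = conv f (conv g h) a" .
qed

lemma conv_unit_left: "conv unit_fun f = f"
proof
  fix a
  have "conv unit_fun f a = lext f (lext (\<lambda>(a, b). cmul (eps a) (basis b)) (db a))"
    by (simp add: conv_def unit_fun_def lext_comp case_prod_unfold blext_cmul_left m_unit lext_cmul)
  then show "conv unit_fun f a = f a" by (simp add: counit_basis)
qed

lemma conv_unit_right: "conv f unit_fun = f"
proof
  fix a
  have "conv f unit_fun a = lext f (lext (\<lambda>(a, b). cmul (eps b) (basis a)) (db a))"
    by (simp add: conv_def unit_fun_def lext_comp case_prod_unfold blext_cmul_right m_unit lext_cmul)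
  then show "conv f unit_fun a = f a" by (simp add: counit_basis)
qed

lemma conv_add_left: "conv (\<lambda>a. f a + f' a) g a = conv f g a + conv f' g a"
  by (simp add: conv_def blext_add_left case_prod_unfold lext_fun_add)

lemma conv_add_right: "conv f (\<lambda>a. g a + g' a) a = conv f g a + conv f g' a"
  by (simp add: conv_def blext_add_right case_prod_unfold lext_fun_add)

lemma conv_diff_left: "conv (\<lambda>a. f a - f' a) g a = conv f g a - conv f' g a"
  by (simp add: conv_def blext_diff_left case_prod_unfold lext_fun_diff)

lemma conv_diff_right: "conv f (\<lambda>a. g a - g' a) a = conv f g a - conv f g' a"
  by (simp add: conv_def blext_diff_right case_prod_unfold lext_fun_diff)

text \<open>The projection onto the augmentation ideal. Because it vanishes at \<open>e\<close>,
  each convolution with it lowers the degree that the other factor can see, so the geometric series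
  below is finite in each degree.\<close>

definition aug :: "'b \<Rightarrow> ('b \<Rightarrow>\<^sub>0 'k)" where
  "aug a = (if a = e then 0 else basis a)"

lemma basis_eq_unit_aug: "basis a = unit_fun a + aug a"
  by (simp add: unit_fun_def aug_def eps)

text \<open>Partial sums of the geometric series for the convolution inverse of
  \<open>basis = unit_fun + aug\<close>; in degree d they are constant from index d on.\<close>

primrec antip :: "nat \<Rightarrow> 'b \<Rightarrow> ('b \<Rightarrow>\<^sub>0 'k)" where
  "antip 0 = unit_fun"
| "antip (Suc n) = (\<lambda>a. unit_fun a - conv (antip n) aug a)"

text \<open>In \<open>conv (antip n) aug a\<close> a term with right factor \<open>e\<close>
  vanishes, and every other term evaluates \<open>antip n\<close> in a degree strictly below that of
  \<open>a\<close>.\<close>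

lemma antip_stable: "dg a \<le> n \<Longrightarrow> antip (Suc n) a = antip n a"
proof (induction n arbitrary: a)
  case 0
  then have "a = e" using dg_0 by simp
  then show ?case by (simp add: conv_unit_left aug_def)
next
  case (Suc n)
  have "conv (antip (Suc n)) aug a = conv (antip n) aug a"
  proof (rule conv_cong)
    fix b c assume bc: "(b, c) \<in> Poly_Mapping.keys (db a)"
    show "m (antip (Suc n) b) (aug c) = m (antip n b) (aug c)"
    proof (cases "c = e")
      case False
      then have "dg c \<noteq> 0" using dg_0 by simp
      then have "dg b \<le> n" using dg_db[OF bc] Suc.prems by simp
      then show ?thesis using Suc.IH by simp
    qed (simp add: aug_def)
  qed
  then show ?case by (simp only: antip.simps)
qed

lemma antip_stable': "dg a \<le> n \<Longrightarrow> antip n a = antip (dg a) a"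
proof (induction n)
  case (Suc n)
  show ?case
  proof (cases "dg a \<le> n")
    case True
    then show ?thesis using Suc.IH antip_stable by metis
  next
    case False
    then have "dg a = Suc n" using Suc.prems by simp
    then show ?thesis by simp
  qed
qed simp

text \<open>The partial sums are polynomials in \<open>aug\<close> for convolution. Commutation
  turns the left inverse into a two-sided one.\<close>

lemma conv_aug_commute: "conv aug (antip n) = conv (antip n) aug"
proof (induction n)
  case 0
  then show ?case by (simp add: conv_unit_left conv_unit_right)
next
  case (Suc n)
  show ?case
  proof
    fix a
    have "conv aug (antip (Suc n)) a = aug a - conv aug (conv (antip n) aug) a"
      by (simp add: conv_diff_right conv_unit_right)
    also have "conv aug (conv (antip n) aug) = conv (conv (antip n) aug) aug"
      by (simp add: conv_assoc[symmetric] Suc)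
    also have "aug a - conv (conv (antip n) aug) aug a = conv (antip (Suc n)) aug a"
      by (simp add: conv_diff_left conv_unit_left)
    finally show "conv aug (antip (Suc n)) a = conv (antip (Suc n)) aug a" .
  qed
qed

lemma antipode:
  defines "s \<equiv> \<lambda>a. antip (dg a) a"
  shows "conv s basis a = unit_fun a" "conv basis s a = unit_fun a"
proof -
  let ?n = "dg a"
  have le: "dg b \<le> ?n" "dg c \<le> ?n" if "(b, c) \<in> Poly_Mapping.keys (db a)" for b c
    using dg_db[OF that] by simp_all
  have b: "basis = (\<lambda>a. unit_fun a + aug a)" using basis_eq_unit_aug by blast
  \<comment> \<open>This is the recursion for \<open>antip\<close>, rearranged at an index where the
    next partial sum has the same value.\<close>
  have "antip ?n a + conv (antip ?n) aug a = unit_fun a"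
    using antip_stable[of a ?n] by (simp add: algebra_simps)
  \<comment> \<open>All factors in the coproduct of \<open>a\<close> have degree at most
    \<open>?n\<close>, so a single partial sum replaces the degree-dependent ones.\<close>
  moreover have "conv s basis a = conv (antip ?n) basis a"
    by (rule conv_cong) (simp add: s_def le antip_stable'[of _ ?n])
  then have "conv s basis a = antip ?n a + conv (antip ?n) aug a"
    unfolding b conv_add_right conv_unit_right .
  moreover have "conv basis s a = conv basis (antip ?n) a"
    by (rule conv_cong) (simp add: s_def le antip_stable'[of _ ?n])
  then have "conv basis s a = antip ?n a + conv (antip ?n) aug a"
    unfolding b conv_add_left conv_unit_left conv_aug_commute .
  ultimately show "conv s basis a = unit_fun a" "conv basis s a = unit_fun a" by simp_all
qed

definition epsl :: "('b \<Rightarrow>\<^sub>0 'k) \<Rightarrow> 'k" where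
  "epsl x = (\<Sum>a \<in> Poly_Mapping.keys x. Poly_Mapping.lookup x a * eps a)"

lemma lext_unit_fun: "lext unit_fun x = cmul (epsl x) (basis e)"
  by (simp add: lext_def unit_fun_def epsl_def cmul_sum_left)

text \<open>Degrees add, so by connectedness \<open>e\<close> can occur in a product of basis
  elements only if both factors are \<open>e\<close>.\<close>

lemma unit_fun_mb: "lext unit_fun (mb a b) = cmul (eps a * eps b) (basis e)"
proof (cases "a = e \<and> b = e")
  case True
  then show ?thesis by (simp add: unit_basis eps unit_fun_def)
next
  case False
  then have "dg a + dg b \<noteq> 0" using dg_0 by simp
  then have "c \<noteq> e" if "c \<in> Poly_Mapping.keys (mb a b)" for c
    using dg_mb[OF that] dg_0 by metis
  then have "lext unit_fun (mb a b) = lext (\<lambda>_. 0) (mb a b)"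
    by (intro lext_cong) (simp add: unit_fun_def eps)
  then show ?thesis using False by (auto simp: eps)
qed

lemma epsl_m: "epsl (m x y) = epsl x * epsl y"
proof -
  \<comment> \<open>The counit is carried as a multiple of \<open>basis e\<close>, so that the rules
    for \<open>lext\<close> apply; the coefficient at \<open>e\<close> gives the scalar back at the
    end.\<close>
  have "cmul (epsl (m x y)) (basis e) = lext (\<lambda>a. lext (\<lambda>b. cmul (eps a * eps b) (basis e)) y) x"
    unfolding lext_unit_fun[symmetric] blext_def lext_comp unit_fun_mb ..
  also have "\<dots> = lext (\<lambda>a. cmul (eps a) (lext unit_fun y)) x"
    by (simp add: unit_fun_def lext_fun_cmul[symmetric])
  also have "\<dots> = lext (\<lambda>a. cmul (epsl y) (unit_fun a)) x"
    by (simp add: unit_fun_def lext_unit_fun mult.commute)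
  also have "\<dots> = cmul (epsl x * epsl y) (basis e)"
    by (simp add: lext_fun_cmul lext_unit_fun mult.commute)
  finally have "Poly_Mapping.lookup (cmul (epsl (m x y)) (basis e)) e =
      Poly_Mapping.lookup (cmul (epsl x * epsl y) (basis e)) e" by simp
  then show ?thesis by (simp add: basis_def)
qed

theorem graded_hopf_basis: "graded_hopf_basis mb e db eps dg"
proof -
  let ?m2 = "\<lambda>(a, b) (a', b'). tens (mb a a') (mb b b')"
  have coassoc: "lext (\<lambda>(a, b). lext (\<lambda>(c, c'). basis (c, c', b)) (db a)) (lext db x)
         = lext (\<lambda>(a, b). lext (\<lambda>(c, c'). basis (a, c, c')) (db b)) (lext db x)" for x
    unfolding lext_comp coassoc_basis ..
  have counit: "lext (\<lambda>(a, b). cmul (eps a) (basis b)) (lext db x) = x"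
     "lext (\<lambda>(a, b). cmul (eps b) (basis a)) (lext db x) = x" for x
    unfolding lext_comp counit_basis by (rule lext_basis_id)+
  have mult: "lext db (m x y) = blext ?m2 (lext db x) (lext db y)" for x y
  proof -
    have "lext db (m x y) = lext (\<lambda>a. lext (\<lambda>b. blext ?m2 (db a) (db b)) y) x"
      unfolding blext_def[of mb] lext_comp mult_basis ..
    also have "\<dots> = blext ?m2 (lext db x) (lext db y)"
      unfolding blext_lext_left by (intro lext_cong blext_lext_right[symmetric])
    finally show ?thesis .
  qed
  have anti: "\<exists>s. \<forall>x.
      lext (\<lambda>(a, b). m (s a) (basis b)) (lext db x) = cmul (epsl x) (basis e) \<and>
      lext (\<lambda>(a, b). m (basis a) (s b)) (lext db x) = cmul (epsl x) (basis e)"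
    unfolding lext_comp lext_unit_fun[symmetric]
    using antipode unfolding conv_def by (intro exI[of _ "\<lambda>a. antip (dg a) a"]) simp
  show ?thesis
    unfolding graded_hopf_basis_def Let_def
    using m_assoc m_unit coassoc counit mult db_e epsl_m eps dg_0 dg_mb dg_db anti
    unfolding epsl_def by (intro conjI allI ballI) auto
qed

end

subsection \<open>Standardization\<close>

text \<open>Any tree with distinct labels represents an n-tree. Working with representatives removes
  standardizations from the inside of formulas.\<close>

definition cls :: "rtree \<Rightarrow> ntree" where
  "cls t = Abs_ntree (std t)"

definition rank :: "nat set \<Rightarrow> nat \<Rightarrow> nat" where
  "rank X a = card {b \<in> X. b \<le> a}"

lemma std_rank: "std t = relabelF (rank (set (postF t))) t"
  by (simp add: std_def rank_def[abs_def])

lemma rank_strict_mono: "finite X \<Longrightarrow> strict_mono_on X (rank X)"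
proof (rule strict_mono_onI)
  fix r s assume "finite X" "r \<in> X" "s \<in> X" "r < s"
  then have "{b \<in> X. b \<le> r} \<subset> {b \<in> X. b \<le> s}" by (auto simp: psubset_eq set_eq_iff intro!: exI[of _ s])
  then show "rank X r < rank X s" unfolding rank_def using \<open>finite X\<close> by (intro psubset_card_mono) auto
qed

lemma rank_image:
  assumes "strict_mono_on X g" "a \<in> X"
  shows "rank (g ` X) (g a) = rank X a"
proof -
  have "{b \<in> g ` X. b \<le> g a} = g ` {b \<in> X. b \<le> a}"
    using assms by (auto simp: strict_mono_on_leD strict_mono_on_less_eq)
  moreover have "inj_on g {b \<in> X. b \<le> a}"
    using strict_mono_on_imp_inj_on[OF assms(1)] by (rule inj_on_subset) auto
  ultimately show ?thesis by (simp add: rank_def card_image)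
qed

lemma std_relabelF:
  assumes "strict_mono_on (set (postF t)) g"
  shows "std (relabelF g t) = std t"
  unfolding std_rank relabelF_relabelF postF_relabelF set_map
  using rank_image[OF assms] by (rule relabelF_cong)

lemma cls_relabelF: "strict_mono_on (set (postF t)) g \<Longrightarrow> cls (relabelF g t) = cls t"
  by (simp add: cls_def std_relabelF)

lemma inj_on_rank: "inj_on (rank (set (postF t))) (set (postF t))"
  by (rule strict_mono_on_imp_inj_on) (simp add: rank_strict_mono)

lemma is_ntree_std:
  assumes "distinct (postF t)"
  shows "is_ntree (std t)"
proof -
  let ?X = "set (postF t)"
  have "card (rank ?X ` ?X) = card ?X" using inj_on_rank by (rule card_image)
  moreover have "rank ?X ` ?X \<subseteq> {1..card ?X}"
  proof
    fix r assume "r \<in> rank ?X ` ?X"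
    then obtain a where a: "a \<in> ?X" "r = rank ?X a" by blast
    have "rank ?X a \<le> card ?X" unfolding rank_def by (intro card_mono) auto
    moreover have "rank ?X a \<noteq> 0" using a by (auto simp: rank_def)
    ultimately show "r \<in> {1..card ?X}" using a by simp
  qed
  ultimately have "rank ?X ` ?X = {1..card ?X}" by (intro card_subset_eq) auto
  then show ?thesis
    using assms inj_on_rank
    by (simp add: is_ntree_def std_rank deg_def distinct_map distinct_card)
qed

lemma std_ntree:
  assumes "is_ntree t"
  shows "std t = t"
  unfolding std_rank
proof (rule relabelF_id)
  fix a assume a: "a \<in> set (postF t)"
  then have "{b \<in> set (postF t). b \<le> a} = {1..a}" using assms by (auto simp: is_ntree_def)
  then show "rank (set (postF t)) a = a" by (simp add: rank_def)
qed

lemma tree_of_cls: "distinct (postF t) \<Longrightarrow> tree_of (cls t) = std t"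
  by (simp add: cls_def Abs_ntree_inverse is_ntree_std)

lemma is_ntree_tree_of: "is_ntree (tree_of t)"
  using tree_of by simp

lemma distinct_tree_of: "distinct (postF (tree_of t))"
  using is_ntree_tree_of by (simp add: is_ntree_def)

lemma cls_tree_of: "cls (tree_of t) = t"
  by (simp add: cls_def std_ntree is_ntree_tree_of tree_of_inverse)

lemma ndeg_cls: "distinct (postF t) \<Longrightarrow> ndeg (cls t) = deg t"
  by (simp add: ndeg_def tree_of_cls std_rank deg_def)

lemma deg_0_iff: "deg t = 0 \<longleftrightarrow> t = []"
  by (simp add: deg_def)

lemma cls_Nil: "cls [] = unit_tree"
  by (simp add: cls_def unit_tree_def std_def)

lemma ndeg_0_iff: "ndeg t = 0 \<longleftrightarrow> t = unit_tree"
proof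
  assume "ndeg t = 0"
  then have "tree_of t = []" by (simp add: ndeg_def deg_0_iff)
  then show "t = unit_tree" using cls_tree_of[of t] cls_Nil by simp
next
  assume "t = unit_tree"
  then show "ndeg t = 0" using ndeg_cls[of "[]"] cls_Nil by (simp add: deg_0_iff)
qed

lemma cls_eq_unit_iff: "distinct (postF t) \<Longrightarrow> cls t = unit_tree \<longleftrightarrow> t = []"
  using ndeg_0_iff[of "cls t"] by (simp add: ndeg_cls deg_0_iff)

lemma cls_shift: "cls (shift m (tree_of t)) = t"
  unfolding shift_def by (subst cls_relabelF) (simp_all add: strict_mono_on_def cls_tree_of)

lemma postF_shift: "postF (shift m t) = map (\<lambda>a. a + m) (postF t)"
  by (simp add: shift_def)

lemma distinct_shift: "distinct (postF (shift m t)) \<longleftrightarrow> distinct (postF t)"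
  by (simp add: postF_shift distinct_map inj_on_def)

section \<open>Representatives with separated label sets, and the star product on them\<close>

definition separated :: "rtree \<Rightarrow> rtree \<Rightarrow> bool" where
  "separated t u \<longleftrightarrow> (\<forall>a \<in> set (postF t). \<forall>b \<in> set (postF u). a < b)"

lemma separated_disjoint: "separated t u \<Longrightarrow> set (postF t) \<inter> set (postF u) = {}"
  by (auto simp: separated_def)

lemma separated_tree_of_shift: "ndeg t \<le> m \<Longrightarrow> separated (tree_of t) (shift m (tree_of u))"
  using is_ntree_tree_of[of t] is_ntree_tree_of[of u]
  by (auto simp: separated_def postF_shift is_ntree_def ndeg_def)

lemma separated_shift_shift:
  "l + ndeg t \<le> m \<Longrightarrow> separated (shift l (tree_of t)) (shift m (tree_of u))"
  using is_ntree_tree_of[of t] is_ntree_tree_of[of u]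
  by (fastforce simp: separated_def postF_shift is_ntree_def ndeg_def)

text \<open>These representatives have the shift of the star product already built in. Separation,
  unlike an exact shift, is inherited by intervals.\<close>

lemma separated_pairE:
  obtains t' u' where "t = cls t'" "u = cls u'" "distinct (postF t')" "distinct (postF u')"
    "separated t' u'"
proof
  show "t = cls (tree_of t)" "u = cls (shift (ndeg t) (tree_of u))"
    by (simp_all add: cls_tree_of cls_shift)
qed (simp_all add: distinct_tree_of distinct_shift separated_tree_of_shift)

lemma separated_tripleE:
  obtains t' u' v' where "t = cls t'" "u = cls u'" "v = cls v'"
    "distinct (postF t')" "distinct (postF u')" "distinct (postF v')"
    "separated t' u'" "separated t' v'" "separated u' v'"
proof
  show "t = cls (tree_of t)" "u = cls (shift (ndeg t) (tree_of u))"
    "v = cls (shift (ndeg t + ndeg u) (tree_of v))"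
    by (simp_all add: cls_tree_of cls_shift)
qed (simp_all add: distinct_tree_of distinct_shift separated_tree_of_shift separated_shift_shift)

text \<open>One increasing relabelling of the joint label set standardizes \<open>t\<close> and, at
  the same time, sends \<open>u\<close> to its shifted standardization; gluing commutes with
  it.\<close>

lemma star_cls:
  assumes t: "distinct (postF t)" and u: "distinct (postF u)" and sep: "separated t u"
  shows "star_basis (cls t) (cls u) =
    (\<Sum>w \<in> shuffles (postF t) (postF u). basis (cls (glue t u w)) :: ntree \<Rightarrow>\<^sub>0 'k::field)"
proof -
  let ?T = "set (postF t)" and ?U = "set (postF u)"
  define g where "g = rank (?T \<union> ?U)"
  note disj = separated_disjoint[OF sep]
  have inj: "inj_on g (?T \<union> ?U)"
    unfolding g_def by (rule strict_mono_on_imp_inj_on) (simp add: rank_strict_mono)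
  have gt: "relabelF g t = std t" unfolding std_rank
  proof (rule relabelF_cong)
    fix a assume "a \<in> ?T"
    then have "{b \<in> ?T \<union> ?U. b \<le> a} = {b \<in> ?T. b \<le> a}" using sep by (fastforce simp: separated_def)
    then show "g a = rank ?T a" by (simp add: g_def rank_def)
  qed
  have gu: "relabelF g u = shift (deg t) (std u)"
    unfolding std_rank shift_def relabelF_relabelF
  proof (rule relabelF_cong)
    fix a assume "a \<in> ?U"
    then have "{b \<in> ?T \<union> ?U. b \<le> a} = {b \<in> ?U. b \<le> a} \<union> ?T" using sep by (fastforce simp: separated_def)
    moreover have "{b \<in> ?U. b \<le> a} \<inter> ?T = {}" using disj by auto
    ultimately have "rank (?T \<union> ?U) a = rank ?U a + card ?T"
      unfolding rank_def by (simp add: card_Un_disjoint)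
    then show "g a = rank ?U a + deg t" by (simp add: g_def deg_def distinct_card[OF t])
  qed
  have "star_basis (cls t) (cls u) =
      (graft_sum (relabelF g t) (relabelF g u) :: ntree \<Rightarrow>\<^sub>0 'k)"
    by (simp add: star_basis_def tree_of_cls t u ndeg_cls gt gu)
  also have "\<dots> = (\<Sum>w \<in> shuffles (map g (postF t)) (map g (postF u)).
      basis (Abs_ntree (glue (relabelF g t) (relabelF g u) w)))"
  proof -
    have "distinct (postF (relabelF g t))" "distinct (postF (relabelF g u))"
      using inj t u by (auto simp: distinct_map intro: inj_on_subset)
    moreover have "set (postF (relabelF g t)) \<inter> set (postF (relabelF g u)) = {}"
      using inj disj by (simp add: inj_on_image_Int[OF inj, symmetric])
    ultimately show ?thesis by (simp only: graft_sum_shuffles postF_relabelF)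
  qed
  also have "\<dots> = (\<Sum>w \<in> shuffles (postF t) (postF u).
      basis (Abs_ntree (glue (relabelF g t) (relabelF g u) (map g w))))"
    unfolding map_shuffles
  proof (rule sum.reindex_cong[OF _ refl refl])
    show "inj_on (map g) (shuffles (postF t) (postF u))"
    proof (rule inj_onI)
      fix v w assume "v \<in> shuffles (postF t) (postF u)" "w \<in> shuffles (postF t) (postF u)" "map g v = map g w"
      then show "v = w" using inj by (metis map_inj_on set_shuffles Un_absorb)
    qed
  qed
  also have "\<dots> = (\<Sum>w \<in> shuffles (postF t) (postF u). basis (cls (glue t u w)))"
  proof (rule sum.cong[OF refl])
    fix w assume w: "w \<in> shuffles (postF t) (postF u)"
    \<comment> \<open>The glued tree carries exactly the labels of both trees, so \<open>g\<close>
      is its standardizing map.\<close>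
    have "std (glue t u w) = relabelF g (glue t u w)"
      by (simp add: std_rank glue_props[OF t u disj w] set_shuffles[OF w] g_def)
    then show "basis (Abs_ntree (glue (relabelF g t) (relabelF g u) (map g w))) =
        (basis (cls (glue t u w)) :: ntree \<Rightarrow>\<^sub>0 'k)"
      using glue_relabelF[OF t u disj w inj] by (simp add: cls_def)
  qed
  finally show ?thesis .
qed

section \<open>Intervals, and the coproduct on representatives\<close>

lemma postF_interval_tree:
  assumes "distinct (postF t)"
  shows "postF (interval_tree i j t) = drop i (take j (postF t))"
proof (cases "i \<le> j")
  case True
  have "postF t = take i (take j (postF t)) @ drop i (take j (postF t)) @ drop j (postF t)"
    by (metis append.assoc append_take_drop_id)
  then show ?thesis
    using filter_middle[of "take i (take j (postF t))" "drop i (take j (postF t))" "drop j (postF t)"]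
      assms by (simp add: interval_tree_def)
qed (simp add: interval_tree_def)

lemma distinct_interval_tree: "distinct (postF t) \<Longrightarrow> distinct (postF (interval_tree i j t))"
  by (simp add: postF_interval_tree)

lemma interval_tree_relabelF:
  assumes "inj_on g (set (postF t))"
  shows "interval_tree i j (relabelF g t) = relabelF g (interval_tree i j t)"
proof -
  let ?A = "set (drop i (take j (postF t)))"
  have "?A \<subseteq> set (postF t)" by (meson order_trans set_drop_subset set_take_subset)
  then have "set (postF t) \<union> ?A = set (postF t)" by blast
  then have "restrF (g ` ?A) (relabelF g t) = relabelF g (restrF ?A t)"
    using restrF_relabelF[of g t ?A] assms by simp
  then show ?thesis by (simp add: interval_tree_def take_map drop_map)
qed

text \<open>Positions in the inner interval are offset by \<open>i\<close>; the minimum appears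
  because the outer bound may reach past its end.\<close>

lemma interval_tree_interval_tree:
  assumes "distinct (postF t)"
  shows "interval_tree a b (interval_tree i j t) = interval_tree (i + a) (min (i + b) j) t"
proof -
  let ?A = "drop a (take b (drop i (take j (postF t))))"
  have A: "?A = drop (i + a) (take (min (i + b) j) (postF t))"
    by (simp add: take_drop add.commute)
  have "set ?A \<subseteq> set (drop i (take j (postF t)))" by (meson order_trans set_drop_subset set_take_subset)
  then have "set ?A \<inter> set (drop i (take j (postF t))) = set ?A" by blast
  then have "interval_tree a b (interval_tree i j t) = restrF (set ?A) t"
    unfolding interval_tree_def[of a] postF_interval_tree[OF assms]
    unfolding interval_tree_def restrF_restrF by simp
  then show ?thesis by (simp only: A interval_tree_def)
qed

lemma interval_tree_whole: "interval_tree 0 (deg t) t = t"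
  by (simp add: interval_tree_def deg_def restrF_all)

lemma deg_interval_tree: "distinct (postF t) \<Longrightarrow> j \<le> deg t \<Longrightarrow> deg (interval_tree i j t) = j - i"
  by (simp add: deg_def postF_interval_tree)

text \<open>Intervals are cut by position, hence commute with relabelling, and an increasing
  relabelling stays increasing on a part of the labels. So standardizing before cutting changes
  nothing.\<close>

lemma delta_cls:
  assumes t: "distinct (postF t)"
  shows "delta_basis (cls t) =
    (\<Sum>k \<in> {0..deg t}. basis (cls (interval_tree 0 k t), cls (interval_tree k (deg t) t)))"
proof -
  have "cls (interval_tree i j (std t)) = cls (interval_tree i j t)" for i j
  proof -
    have "set (postF (interval_tree i j t)) \<subseteq> set (postF t)" by (auto simp: interval_tree_def)
    then have "strict_mono_on (set (postF (interval_tree i j t))) (rank (set (postF t)))"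
      using rank_strict_mono[of "set (postF t)"] by (auto simp: strict_mono_on_def)
    then show ?thesis
      unfolding std_rank by (simp add: interval_tree_relabelF inj_on_rank cls_relabelF)
  qed
  then show ?thesis
    unfolding delta_basis_def by (simp add: tree_of_cls ndeg_cls t flip: cls_def)
qed

subsection \<open>The bialgebra axioms on the basis\<close>

lemma filter_shuffle:
  assumes "w \<in> shuffles xs ys" "\<And>x. x \<in> set xs \<Longrightarrow> P x" "\<And>y. y \<in> set ys \<Longrightarrow> \<not> P y"
  shows "filter P w = xs" "filter (\<lambda>x. \<not> P x) w = ys"
proof -
  have "filter P xs = xs" "filter P ys = []" "filter (\<lambda>x. \<not> P x) xs = []" "filter (\<lambda>x. \<not> P x) ys = ys"
    using assms by (auto simp: filter_id_conv filter_empty_conv)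
  moreover have "filter P w \<in> shuffles (filter P xs) (filter P ys)"
    "filter (\<lambda>x. \<not> P x) w \<in> shuffles (filter (\<lambda>x. \<not> P x) xs) (filter (\<lambda>x. \<not> P x) ys)"
    using assms(1) unfolding filter_shuffles[symmetric] by blast+
  ultimately show "filter P w = xs" "filter (\<lambda>x. \<not> P x) w = ys" by simp_all
qed

lemma star_assoc_basis:
  "lext (\<lambda>p. star_basis p c) (star_basis a b) =
   lext (star_basis a) (star_basis b c :: ntree \<Rightarrow>\<^sub>0 'k::field)"
proof -
  obtain t u v where abc: "a = cls t" "b = cls u" "c = cls v"
    and d: "distinct (postF t)" "distinct (postF u)" "distinct (postF v)"
    and sep: "separated t u" "separated t v" "separated u v"
    by (rule separated_tripleE)
  let ?T = "postF t" and ?U = "postF u" and ?V = "postF v"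
  note disj = sep[THEN separated_disjoint]
  have L: "star_basis (cls (glue t u w)) (cls v) =
      (\<Sum>w' \<in> shuffles w ?V. basis (cls (glue (glue t u w) v w')) :: ntree \<Rightarrow>\<^sub>0 'k)"
    if w: "w \<in> shuffles ?T ?U" for w
  proof -
    note g = glue_props(1)[OF d(1,2) disj(1) w]
    have "distinct w" using distinct_disjoint_shuffles[OF d(1,2) disj(1) w] .
    moreover have "separated (glue t u w) v"
      using sep set_shuffles[OF w] by (auto simp: separated_def g)
    ultimately show ?thesis using star_cls[of "glue t u w" v] d g by simp
  qed
  have R: "star_basis (cls t) (cls (glue u v w)) =
      (\<Sum>w' \<in> shuffles ?T w. basis (cls (glue t (glue u v w) w')) :: ntree \<Rightarrow>\<^sub>0 'k)"
    if w: "w \<in> shuffles ?U ?V" for w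
  proof -
    note g = glue_props(1)[OF d(2,3) disj(3) w]
    have "distinct w" using distinct_disjoint_shuffles[OF d(2,3) disj(3) w] .
    moreover have "separated t (glue u v w)"
      using sep set_shuffles[OF w] by (auto simp: separated_def g)
    ultimately show ?thesis using star_cls[of t "glue u v w"] d g by simp
  qed
  have "lext (\<lambda>p. star_basis p c) (star_basis a b) =
      (\<Sum>w \<in> shuffles ?T ?U. \<Sum>w' \<in> shuffles w ?V. basis (cls (glue (glue t u w) v w')) :: ntree \<Rightarrow>\<^sub>0 'k)"
    unfolding abc star_cls[OF d(1,2) sep(1)] lext_sum_basis using L by (intro sum.cong) auto
  also have "\<dots> = (\<Sum>(w, w') \<in> (SIGMA w : shuffles ?T ?U. shuffles w ?V).
      basis (cls (glue (glue t u w) v w')))"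
    by (simp add: sum.Sigma)
  also have "\<dots> = (\<Sum>(w, w') \<in> (SIGMA w : shuffles ?U ?V. shuffles ?T w).
      basis (cls (glue t (glue u v w) w')))"
  proof -
    \<comment> \<open>The triple shuffle \<open>w'\<close> is kept. The intermediate word is
      redundant: it is \<open>w'\<close> without the letters of \<open>v\<close> on one side and
      without those of \<open>t\<close> on the other.\<close>
    let ?i = "\<lambda>(w :: nat list, w'). (filter (\<lambda>x. x \<notin> set ?V) w', w')"
    let ?j = "\<lambda>(w :: nat list, w'). (filter (\<lambda>x. x \<notin> set ?T) w', w')"
    have 1: "?i (?j p) = p" "?j p \<in> (SIGMA w : shuffles ?U ?V. shuffles ?T w)"
      if pD: "p \<in> (SIGMA w : shuffles ?T ?U. shuffles w ?V)" for p
    proof -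
      obtain w w' where p: "p = (w, w')" "w \<in> shuffles ?T ?U" "w' \<in> shuffles w ?V" using pD by auto
      note s = set_shuffles[OF p(2)]
      have V: "filter (\<lambda>x. x \<notin> set ?V) w' = w"
        by (rule filter_shuffle(1)[OF p(3)]) (use s disj in auto)
      then show "?i (?j p) = p" using p by simp
      have "filter (\<lambda>x. x \<notin> set ?T) w = ?U" "filter (\<lambda>x. x \<in> set ?T) w = ?T"
        using filter_shuffle[OF p(2), of "\<lambda>x. x \<in> set ?T"] disj by auto
      moreover have "filter (\<lambda>x. x \<notin> set ?T) ?V = ?V" "filter (\<lambda>x. x \<in> set ?T) ?V = []"
        using disj by (auto simp: filter_id_conv filter_empty_conv)
      moreover have "filter P w' \<in> shuffles (filter P w) (filter P ?V)" for P
        using p(3) filter_shuffles[of P w ?V] by blast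
      from this[of "\<lambda>x. x \<notin> set ?T"] this[of "\<lambda>x. x \<in> set ?T"]
      have "filter (\<lambda>x. x \<notin> set ?T) w' \<in> shuffles (filter (\<lambda>x. x \<notin> set ?T) w) (filter (\<lambda>x. x \<notin> set ?T) ?V)"
       "filter (\<lambda>x. x \<in> set ?T) w' \<in> shuffles (filter (\<lambda>x. x \<in> set ?T) w) (filter (\<lambda>x. x \<in> set ?T) ?V)"
        by blast+
      ultimately have "filter (\<lambda>x. x \<notin> set ?T) w' \<in> shuffles ?U ?V" "filter (\<lambda>x. x \<in> set ?T) w' = ?T"
        by simp_all
      then show "?j p \<in> (SIGMA w : shuffles ?U ?V. shuffles ?T w)"
        using partition_in_shuffles[of w' "\<lambda>x. x \<in> set ?T"] p by simp
    qed
    have 2: "?j (?i p) = p" "?i p \<in> (SIGMA w : shuffles ?T ?U. shuffles w ?V)"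
      if pD: "p \<in> (SIGMA w : shuffles ?U ?V. shuffles ?T w)" for p
    proof -
      obtain w w' where p: "p = (w, w')" "w \<in> shuffles ?U ?V" "w' \<in> shuffles ?T w" using pD by auto
      note s = set_shuffles[OF p(2)]
      have "filter (\<lambda>x. x \<notin> set ?T) w' = w"
        by (rule filter_shuffle(2)[OF p(3)]) (use s disj in auto)
      then show "?j (?i p) = p" using p by simp
      have "filter (\<lambda>x. x \<notin> set ?V) w = ?U" "filter (\<lambda>x. x \<in> set ?V) w = ?V"
        using filter_shuffle[OF p(2), of "\<lambda>x. x \<notin> set ?V"] disj by auto
      moreover have "filter (\<lambda>x. x \<notin> set ?V) ?T = ?T" "filter (\<lambda>x. x \<in> set ?V) ?T = []"
        using disj by (auto simp: filter_id_conv filter_empty_conv)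
      moreover have "filter P w' \<in> shuffles (filter P ?T) (filter P w)" for P
        using p(3) filter_shuffles[of P ?T w] by blast
      from this[of "\<lambda>x. x \<notin> set ?V"] this[of "\<lambda>x. x \<in> set ?V"]
      have "filter (\<lambda>x. x \<notin> set ?V) w' \<in> shuffles (filter (\<lambda>x. x \<notin> set ?V) ?T) (filter (\<lambda>x. x \<notin> set ?V) w)"
       "filter (\<lambda>x. x \<in> set ?V) w' \<in> shuffles (filter (\<lambda>x. x \<in> set ?V) ?T) (filter (\<lambda>x. x \<in> set ?V) w)"
        by blast+
      ultimately have "filter (\<lambda>x. x \<notin> set ?V) w' \<in> shuffles ?T ?U" "filter (\<lambda>x. x \<in> set ?V) w' = ?V"
        by simp_all
      then show "?i p \<in> (SIGMA w : shuffles ?T ?U. shuffles w ?V)"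
        using partition_in_shuffles[of w' "\<lambda>x. x \<notin> set ?V"] p by simp
    qed
    show ?thesis
    proof (rule sum.reindex_bij_witness[of _ ?i ?j])
      fix p assume p: "p \<in> (SIGMA w : shuffles ?T ?U. shuffles w ?V)"
      obtain w w' where ww: "p = (w, w')" by (cases p)
      show "(case ?j p of (w, w') \<Rightarrow> basis (cls (glue t (glue u v w) w'))) =
          (case p of (w, w') \<Rightarrow> (basis (cls (glue (glue t u w) v w')) :: ntree \<Rightarrow>\<^sub>0 'k))"
        using glue_assoc[OF d disj, of w w' "filter (\<lambda>x. x \<notin> set ?T) w'"] p 1(2)[OF p] ww by simp
    qed (use 1 2 in auto)
  qed
  also have "\<dots> = (\<Sum>w \<in> shuffles ?U ?V. \<Sum>w' \<in> shuffles ?T w. basis (cls (glue t (glue u v w) w')))"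
    by (simp add: sum.Sigma)
  also have "\<dots> = lext (star_basis a) (star_basis b c)"
    unfolding abc star_cls[OF d(2,3) sep(3)] lext_sum_basis using R by (intro sum.cong) auto
  finally show ?thesis .
qed

lemma star_unit_basis: "star_basis unit_tree a = basis a" "star_basis a unit_tree = basis a"
proof -
  let ?t = "tree_of a"
  note d = distinct_tree_of[of a]
  have "descF ?t = glue_desc [] ?t (postF ?t)" using descF_bef[of ?t] by (auto simp: glue_desc_def)
  then have "glue [] ?t (postF ?t) = ?t" by (intro glueI d refl)
  then show "star_basis unit_tree a = basis a"
    using star_cls[of "[]" ?t] d by (simp add: cls_Nil cls_tree_of separated_def)
  have "glue ?t [] (postF ?t) = ?t" by (intro glueI d refl glue_Nil)
  then show "star_basis a unit_tree = basis a"
    using star_cls[of ?t "[]"] d by (simp add: cls_Nil cls_tree_of separated_def)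
qed

lemma delta_coassoc_basis:
  "lext (\<lambda>(a, b). lext (\<lambda>(c, c'). basis (c, c', b)) (delta_basis a)) (delta_basis x) =
   lext (\<lambda>(a, b). lext (\<lambda>(c, c'). basis (a, c, c')) (delta_basis b))
     (delta_basis x :: ntree \<times> ntree \<Rightarrow>\<^sub>0 'k::field)" (is "?L = ?R")
proof -
  define t where "t = tree_of x"
  define n where "n = deg t"
  have x: "x = cls t" and t: "distinct (postF t)"
    by (simp_all add: t_def cls_tree_of distinct_tree_of)
  define I where "I i j = cls (interval_tree i j t)" for i j
  have dI: "delta_basis (I i j) = (\<Sum>k \<in> {0..j - i}. basis (I i (i + k), I (i + k) j))"
    if "i \<le> j" "j \<le> n" for i j
    using that
    by (auto simp: I_def delta_cls[OF distinct_interval_tree[OF t]] deg_interval_tree[OF t] n_def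
        interval_tree_interval_tree[OF t] min_def intro!: sum.cong)
  have dx: "delta_basis x = (\<Sum>k \<in> {0..n}. basis (I 0 k, I k n))"
    by (simp add: x delta_cls[OF t] I_def n_def)
  have "?L = (\<Sum>k \<in> {0..n}. \<Sum>j \<in> {0..k}. basis (I 0 j, I j k, I k n))"
    unfolding dx lext_sum_basis prod.case
    by (intro sum.cong refl) (simp add: dI lext_sum_basis)
  also have "\<dots> = (\<Sum>(k, j) \<in> (SIGMA k : {0..n}. {0..k}). basis (I 0 j, I j k, I k n))"
    by (simp add: sum.Sigma)
  \<comment> \<open>Both sides run over two cut points. On the left the later one is chosen first;
    on the right it is given by its distance from the earlier one.\<close>
  also have "\<dots> = (\<Sum>(k, j) \<in> (SIGMA k : {0..n}. {0..n - k}). basis (I 0 k, I k (k + j), I (k + j) n))"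
    by (rule sum.reindex_bij_witness[of _ "\<lambda>(k, j). (k + j, k)" "\<lambda>(k, j). (j, k - j)"]) auto
  also have "\<dots> = (\<Sum>k \<in> {0..n}. \<Sum>j \<in> {0..n - k}. basis (I 0 k, I k (k + j), I (k + j) n))"
    by (simp add: sum.Sigma)
  also have "\<dots> = ?R"
    unfolding dx lext_sum_basis prod.case
    by (intro sum.cong refl) (simp add: dI lext_sum_basis)
  finally show ?thesis .
qed

lemma delta_counit_basis:
  "lext (\<lambda>(a, b). cmul (counit_basis a) (basis b)) (delta_basis x) = (basis x :: ntree \<Rightarrow>\<^sub>0 'k::field)"
  "lext (\<lambda>(a, b). cmul (counit_basis b) (basis a)) (delta_basis x) = (basis x :: ntree \<Rightarrow>\<^sub>0 'k::field)"
proof -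
  define t where "t = tree_of x"
  have x: "x = cls t" and t: "distinct (postF t)"
    by (simp_all add: t_def cls_tree_of distinct_tree_of)
  have unit: "counit_basis (cls (interval_tree i j t)) = (if j - i = 0 then 1 else 0 :: 'k)"
    if "j \<le> deg t" for i j
    unfolding counit_basis_def cls_eq_unit_iff[OF distinct_interval_tree[OF t]] deg_0_iff[symmetric]
      deg_interval_tree[OF t that] ..
  have "lext (\<lambda>(a, b). cmul (counit_basis a) (basis b)) (delta_basis x) =
      (\<Sum>k \<in> {0..deg t}. if k = 0 then basis x else 0 :: ntree \<Rightarrow>\<^sub>0 'k)"
    unfolding x delta_cls[OF t] lext_sum_basis prod.case
    by (intro sum.cong refl) (auto simp: unit interval_tree_whole)
  then show "lext (\<lambda>(a, b). cmul (counit_basis a) (basis b)) (delta_basis x) = (basis x :: ntree \<Rightarrow>\<^sub>0 'k)"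
    by simp
  have "lext (\<lambda>(a, b). cmul (counit_basis b) (basis a)) (delta_basis x) =
      (\<Sum>k \<in> {0..deg t}. if k = deg t then basis x else 0 :: ntree \<Rightarrow>\<^sub>0 'k)"
    unfolding x delta_cls[OF t] lext_sum_basis prod.case
    by (intro sum.cong refl) (auto simp: unit interval_tree_whole)
  then show "lext (\<lambda>(a, b). cmul (counit_basis b) (basis a)) (delta_basis x) = (basis x :: ntree \<Rightarrow>\<^sub>0 'k)"
    by simp
qed

text \<open>A prefix and a suffix of a word are convex, so \<open>glue_restrF\<close> applies;
  \<open>i\<close> and \<open>j\<close> record how many letters of \<open>t\<close> and
  \<open>u\<close> fall into the prefix.\<close>

lemma glue_take_drop:
  assumes d: "distinct (postF t)" "distinct (postF u)" and disj: "set (postF t) \<inter> set (postF u) = {}"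
    and w: "w1 @ w2 \<in> shuffles (postF t) (postF u)"
    and t: "filter (\<lambda>x. x \<in> set (postF t)) w1 = take i (postF t)"
           "filter (\<lambda>x. x \<in> set (postF t)) w2 = drop i (postF t)"
    and u: "filter (\<lambda>x. x \<in> set (postF u)) w1 = take j (postF u)"
           "filter (\<lambda>x. x \<in> set (postF u)) w2 = drop j (postF u)"
  shows "interval_tree 0 (length w1) (glue t u (w1 @ w2)) =
      glue (interval_tree 0 i t) (interval_tree 0 j u) w1"
    and "interval_tree (length w1) (length (w1 @ w2)) (glue t u (w1 @ w2)) =
      glue (interval_tree i (deg t) t) (interval_tree j (deg u) u) w2"
proof -
  note g = glue_props(1)[OF d disj w]
  have dw: "distinct (w1 @ w2)" using distinct_disjoint_shuffles[OF d disj w] .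
  have r: "restrF (set w) s = restrF (set ps) s" if "filter (\<lambda>x. x \<in> set (postF s)) w = ps" for w ps s
    using that by (intro restrF_cong) auto
  have "interval_tree 0 (length w1) (glue t u (w1 @ w2)) = restrF (set w1) (glue t u (w1 @ w2))"
    by (simp add: interval_tree_def g)
  also have "\<dots> = glue (restrF (set w1) t) (restrF (set w1) u) (filter (\<lambda>a. a \<in> set w1) (w1 @ w2))"
    using dw by (intro glue_restrF[OF d disj w]) (auto simp: bef_append dest: befD)
  also have "filter (\<lambda>a. a \<in> set w1) (w1 @ w2) = w1"
    using filter_middle[of "[]" w1 w2] dw by simp
  finally show "interval_tree 0 (length w1) (glue t u (w1 @ w2)) =
      glue (interval_tree 0 i t) (interval_tree 0 j u) w1"
    by (simp add: interval_tree_def r[OF t(1)] r[OF u(1)])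
  have "interval_tree (length w1) (length (w1 @ w2)) (glue t u (w1 @ w2)) = restrF (set w2) (glue t u (w1 @ w2))"
    by (simp add: interval_tree_def g)
  also have "\<dots> = glue (restrF (set w2) t) (restrF (set w2) u) (filter (\<lambda>a. a \<in> set w2) (w1 @ w2))"
    using dw by (intro glue_restrF[OF d disj w]) (auto simp: bef_append dest: befD)
  also have "filter (\<lambda>a. a \<in> set w2) (w1 @ w2) = w2"
    using filter_middle[of w1 w2 "[]"] dw by simp
  finally show "interval_tree (length w1) (length (w1 @ w2)) (glue t u (w1 @ w2)) =
      glue (interval_tree i (deg t) t) (interval_tree j (deg u) u) w2"
    by (simp add: interval_tree_def r[OF t(2)] r[OF u(2)] deg_def)
qed

lemma tens_sum_basis:
  "tens (\<Sum>i \<in> I. basis (g i)) (\<Sum>j \<in> J. basis (h j)) = (\<Sum>i \<in> I. \<Sum>j \<in> J. basis (g i, h j))"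
  by (simp add: tens_def blext_sum_basis)

lemma separated_interval_tree:
  "separated t u \<Longrightarrow> separated (interval_tree i j t) (interval_tree k l u)"
  by (auto simp: separated_def interval_tree_def)

text \<open>A shuffle with a cut is the same as a cut of each of the two words together with a
  shuffle of the prefixes and one of the suffixes; \<open>glue_take_drop\<close> matches the
  trees.\<close>

lemma delta_star_basis:
  "lext delta_basis (star_basis a b) =
   blext (\<lambda>(a, b) (a', b'). tens (star_basis a a') (star_basis b b')) (delta_basis a)
     (delta_basis b :: ntree \<times> ntree \<Rightarrow>\<^sub>0 'k::field)"
proof -
  obtain t u where ab: "a = cls t" "b = cls u"
    and d: "distinct (postF t)" "distinct (postF u)" and sep: "separated t u"
    by (rule separated_pairE)
  let ?T = "postF t" and ?U = "postF u"
  let ?m = "deg t" and ?n = "deg u"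
  note disj = separated_disjoint[OF sep]
  define X where "X w k = (basis (cls (interval_tree 0 k (glue t u w)),
      cls (interval_tree k (?m + ?n) (glue t u w))) :: ntree \<times> ntree \<Rightarrow>\<^sub>0 'k)" for w k
  define Y where "Y i j w1 w2 = (basis (cls (glue (interval_tree 0 i t) (interval_tree 0 j u) w1),
      cls (glue (interval_tree i ?m t) (interval_tree j ?n u) w2)) :: ntree \<times> ntree \<Rightarrow>\<^sub>0 'k)" for i j w1 w2
  let ?S = "\<lambda>i j. shuffles (take i ?T) (take j ?U)" and ?S' = "\<lambda>i j. shuffles (drop i ?T) (drop j ?U)"
  let ?D = "SIGMA p : {0..?m} \<times> {0..?n}. ?S (fst p) (snd p) \<times> ?S' (fst p) (snd p)"
  have "lext delta_basis (star_basis a b) = (\<Sum>w \<in> shuffles ?T ?U. \<Sum>k \<in> {0..?m + ?n}. X w k)"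
    unfolding ab star_cls[OF d sep] lext_sum_basis
  proof (rule sum.cong[OF refl])
    fix w assume w: "w \<in> shuffles ?T ?U"
    note g = glue_props(1)[OF d disj w]
    have "distinct w" using distinct_disjoint_shuffles[OF d disj w] .
    moreover have "deg (glue t u w) = ?m + ?n" using g length_shuffles[OF w] by (simp add: deg_def)
    ultimately show "delta_basis (cls (glue t u w)) = (\<Sum>k \<in> {0..?m + ?n}. X w k)"
      using delta_cls[of "glue t u w"] g by (simp add: X_def)
  qed
  also have "\<dots> = (\<Sum>(w, k) \<in> shuffles ?T ?U \<times> {0..?m + ?n}. X w k)"
    by (simp add: sum.cartesian_product)
  also have "\<dots> = (\<Sum>((i, j), (w1, w2)) \<in> ?D. Y i j w1 w2)"
  proof -
    let ?P = "\<lambda>x. x \<in> set ?T" and ?Q = "\<lambda>x. x \<in> set ?U"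
    let ?i = "\<lambda>((i :: nat, j :: nat), (w1 :: nat list, w2)). (w1 @ w2, i + j)"
    \<comment> \<open>A cut of \<open>w\<close> at \<open>k\<close> cuts each word after as many
      letters as it contributes to the prefix. These numbers add up to \<open>k\<close>, which is
      how the inverse \<open>?i\<close> finds the cut.\<close>
    let ?j = "\<lambda>(w, k). ((length (filter ?P (take k w)), length (filter ?Q (take k w))), (take k w, drop k w))"
    have len: "length ?T = ?m" "length ?U = ?n" by (simp_all add: deg_def)
    have sT: "set (take i ?T) \<subseteq> set ?T" "set (drop i ?T) \<subseteq> set ?T"
      "set (take i ?U) \<subseteq> set ?U" "set (drop i ?U) \<subseteq> set ?U" for i
      by (simp_all add: set_take_subset set_drop_subset)
    have F: "filter ?P w1 = take i ?T" "filter ?Q w1 = take j ?U"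
      if "w1 \<in> ?S i j" for i j w1
    proof -
      show "filter ?P w1 = take i ?T"
        by (rule filter_shuffle(1)[OF that]) (use disj sT in blast)+
      have "filter (\<lambda>x. \<not> \<not> ?Q x) w1 = take j ?U"
        by (rule filter_shuffle(2)[OF that]) (use disj sT in blast)+
      then show "filter ?Q w1 = take j ?U" by simp
    qed
    have F': "filter ?P w2 = drop i ?T" "filter ?Q w2 = drop j ?U"
      if "w2 \<in> ?S' i j" for i j w2
    proof -
      show "filter ?P w2 = drop i ?T"
        by (rule filter_shuffle(1)[OF that]) (use disj sT in blast)+
      have "filter (\<lambda>x. \<not> \<not> ?Q x) w2 = drop j ?U"
        by (rule filter_shuffle(2)[OF that]) (use disj sT in blast)+
      then show "filter ?Q w2 = drop j ?U" by simp
    qed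
    have not: "filter (\<lambda>x. \<not> ?P x) w = filter ?Q w" if "set w \<subseteq> set ?T \<union> set ?U" for w
      using that disj by (intro filter_cong) auto
    have 1: "?i p \<in> shuffles ?T ?U \<times> {0..?m + ?n}" "?j (?i p) = p" if pD: "p \<in> ?D" for p
    proof -
      obtain i j w1 w2 where p: "p = ((i, j), (w1, w2))" "i \<le> ?m" "j \<le> ?n" "w1 \<in> ?S i j" "w2 \<in> ?S' i j"
        using pD by auto
      have s: "set (w1 @ w2) \<subseteq> set ?T \<union> set ?U"
        using set_shuffles[OF p(4)] set_shuffles[OF p(5)] sT[of i] sT[of j] by auto
      have "filter ?P (w1 @ w2) = ?T" "filter (\<lambda>x. \<not> ?P x) (w1 @ w2) = ?U"
        unfolding not[OF s] by (simp_all add: F[OF p(4)] F'[OF p(5)])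
      then show "?i p \<in> shuffles ?T ?U \<times> {0..?m + ?n}"
        using partition_in_shuffles[of "w1 @ w2" ?P] p by simp
      have "length w1 = i + j" using length_shuffles[OF p(4)] p len by simp
      then show "?j (?i p) = p" using p len by (simp add: F[OF p(4)])
    qed
    have 2: "?j q \<in> ?D" "?i (?j q) = q" "(\<lambda>((i, j), (w1, w2)). Y i j w1 w2) (?j q) = (\<lambda>(w, k). X w k) q"
      if qD: "q \<in> shuffles ?T ?U \<times> {0..?m + ?n}" for q
    proof -
      obtain w k where q: "q = (w, k)" "w \<in> shuffles ?T ?U" "k \<le> ?m + ?n" using qD by auto
      define w1 w2 i j where "w1 = take k w" and "w2 = drop k w"
        and "i = length (filter ?P w1)" and "j = length (filter ?Q w1)"
      have w: "w = w1 @ w2" by (simp add: w1_def w2_def)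
      have sw: "set w = set ?T \<union> set ?U" using set_shuffles[OF q(2)] .
      have k: "length w1 = k" using length_shuffles[OF q(2)] q(3) len by (simp add: w1_def)
      have "filter ?P w1 @ filter ?P w2 = ?T" "filter ?Q w1 @ filter ?Q w2 = ?U"
        using q(2) in_shuffles_iff[OF disj] w by auto
      then have f: "filter ?P w1 = take i ?T" "filter ?P w2 = drop i ?T"
        "filter ?Q w1 = take j ?U" "filter ?Q w2 = drop j ?U"
        by (metis append_eq_conv_conj i_def j_def)+
      have s: "set w1 \<subseteq> set ?T \<union> set ?U" "set w2 \<subseteq> set ?T \<union> set ?U" using sw w by auto
      have ij: "i \<le> ?m" "j \<le> ?n"
        using arg_cong[OF f(1), of length] arg_cong[OF f(3), of length] len by (simp_all add: i_def j_def)
      have ij_k: "i + j = k"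
      proof -
        have "i + j = length (filter ?P w1) + length (filter (\<lambda>x. \<not> ?P x) w1)"
          by (simp add: i_def j_def not[OF s(1)])
        also have "\<dots> = length w1" by (rule sum_length_filter_compl)
        finally show ?thesis using k by simp
      qed
      have "w1 \<in> ?S i j" "w2 \<in> ?S' i j"
        using partition_in_shuffles[of w1 ?P] partition_in_shuffles[of w2 ?P] f not[OF s(1)] not[OF s(2)]
        by simp_all
      moreover have jq: "?j q = ((i, j), (w1, w2))"
        by (simp add: q(1) i_def j_def w1_def w2_def)
      ultimately show "?j q \<in> ?D" using ij by simp
      show "?i (?j q) = q" unfolding jq by (simp add: q(1) w ij_k)
      have "length (w1 @ w2) = ?m + ?n" using length_shuffles[OF q(2)] len w by simp
      then have "X w k = Y i j w1 w2"
        unfolding X_def Y_def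
        using glue_take_drop[OF d disj _ f(1,2,3,4)] q(2) w k by simp
      then show "(\<lambda>((i, j), (w1, w2)). Y i j w1 w2) (?j q) = (\<lambda>(w, k). X w k) q"
        unfolding jq by (simp add: q(1))
    qed
    show ?thesis
    proof (rule sum.reindex_bij_witness[of _ ?i ?j])
      fix q assume q: "q \<in> shuffles ?T ?U \<times> {0..?m + ?n}"
      show "?i (?j q) = q" by (rule 2(2)[OF q])
      show "?j q \<in> ?D" by (rule 2(1)[OF q])
      show "(\<lambda>((i, j), (w1, w2)). Y i j w1 w2) (?j q) = (\<lambda>(w, k). X w k) q"
        by (rule 2(3)[OF q])
    next
      fix p assume p: "p \<in> ?D"
      show "?j (?i p) = p" by (rule 1(2)[OF p])
      show "?i p \<in> shuffles ?T ?U \<times> {0..?m + ?n}" by (rule 1(1)[OF p])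
    qed
  qed
  also have "\<dots> = (\<Sum>p \<in> {0..?m} \<times> {0..?n}. \<Sum>q \<in> ?S (fst p) (snd p) \<times> ?S' (fst p) (snd p).
      Y (fst p) (snd p) (fst q) (snd q))"
    by (subst sum.Sigma) (auto simp: case_prod_unfold)
  also have "\<dots> = (\<Sum>i \<in> {0..?m}. \<Sum>j \<in> {0..?n}. \<Sum>w1 \<in> ?S i j. \<Sum>w2 \<in> ?S' i j. Y i j w1 w2)"
    by (simp add: sum.cartesian_product case_prod_unfold)
  also have "\<dots> = blext (\<lambda>(a, b) (a', b'). tens (star_basis a a') (star_basis b b')) (delta_basis a) (delta_basis b)"
    unfolding ab delta_cls[OF d(1)] delta_cls[OF d(2)] blext_sum_basis prod.case
  proof (intro sum.cong refl)
    fix i j assume ij: "i \<in> {0..?m}" "j \<in> {0..?n}"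
    have p: "postF (interval_tree 0 k s) = take k (postF s)" "postF (interval_tree k (deg s) s) = drop k (postF s)"
      if "distinct (postF s)" for k s
      using that by (simp_all add: postF_interval_tree deg_def)
    note st = star_cls[OF distinct_interval_tree[OF d(1)] distinct_interval_tree[OF d(2)]
      separated_interval_tree[OF sep]]
    show "(\<Sum>w1 \<in> ?S i j. \<Sum>w2 \<in> ?S' i j. Y i j w1 w2) =
        tens (star_basis (cls (interval_tree 0 i t)) (cls (interval_tree 0 j u)))
          (star_basis (cls (interval_tree i ?m t)) (cls (interval_tree j ?n u)))"
      unfolding st tens_sum_basis p[OF d(1)] p[OF d(2)] Y_def ..
  qed
  finally show ?thesis .
qed

lemma keys_sum_basis: "Poly_Mapping.keys (\<Sum>i \<in> I. basis (g i)) \<subseteq> g ` I"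
  using keys_sum[of "\<lambda>i. basis (g i)" I] by (fastforce simp: basis_def)

lemma ndeg_star_basis:
  assumes "c \<in> Poly_Mapping.keys (star_basis a b :: ntree \<Rightarrow>\<^sub>0 'k::field)"
  shows "ndeg c = ndeg a + ndeg b"
proof -
  obtain t u where ab: "a = cls t" "b = cls u"
    and d: "distinct (postF t)" "distinct (postF u)" and sep: "separated t u"
    by (rule separated_pairE)
  note disj = separated_disjoint[OF sep]
  have "c \<in> (\<lambda>w. cls (glue t u w)) ` shuffles (postF t) (postF u)"
    using assms unfolding ab star_cls[OF d sep] by (rule subsetD[OF keys_sum_basis])
  then obtain w where w: "w \<in> shuffles (postF t) (postF u)" "c = cls (glue t u w)" by blast
  have "distinct w" using distinct_disjoint_shuffles[OF d disj w(1)] .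
  then show ?thesis
    using glue_props(1)[OF d disj w(1)] length_shuffles[OF w(1)] d
    by (simp add: w ab ndeg_cls) (simp add: deg_def)
qed

lemma ndeg_delta_basis:
  assumes "(b, c) \<in> Poly_Mapping.keys (delta_basis a :: ntree \<times> ntree \<Rightarrow>\<^sub>0 'k::field)"
  shows "ndeg b + ndeg c = ndeg a"
proof -
  define t where "t = tree_of a"
  have a: "a = cls t" and t: "distinct (postF t)"
    by (simp_all add: t_def cls_tree_of distinct_tree_of)
  have "(b, c) \<in> (\<lambda>k. (cls (interval_tree 0 k t), cls (interval_tree k (deg t) t))) ` {0..deg t}"
    using assms unfolding a delta_cls[OF t] by (rule subsetD[OF keys_sum_basis])
  then show ?thesis
    by (auto simp: a ndeg_cls t distinct_interval_tree deg_interval_tree)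
qed

lemma delta_unit: "delta_basis unit_tree = basis (unit_tree, unit_tree)"
  using delta_cls[of "[]"] by (simp add: cls_Nil interval_tree_def deg_0_iff[THEN iffD2])

interpretation trees: connected_graded_bialgebra
  "star_basis :: ntree \<Rightarrow> ntree \<Rightarrow> (ntree \<Rightarrow>\<^sub>0 'k::field)" unit_tree delta_basis counit_basis ndeg
  by unfold_locales
    (fact star_assoc_basis star_unit_basis delta_coassoc_basis delta_counit_basis delta_star_basis
      delta_unit counit_basis_def ndeg_0_iff ndeg_star_basis ndeg_delta_basis)+

theorem theorem4p3:
  shows "graded_hopf_basis (star_basis :: ntree \<Rightarrow> ntree \<Rightarrow> (ntree \<Rightarrow>\<^sub>0 'k::field))
            unit_tree delta_basis counit_basis ndeg
         \<and> (\<forall>x y z :: ntree \<Rightarrow>\<^sub>0 'k. star (star x y) z = star x (star y z))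
         \<and> (\<forall>t w :: ntree. delta_s (star (basis t) (basis w) :: ntree \<Rightarrow>\<^sub>0 'k)
               = blext (\<lambda>(a, b) (c, d). tens (star_basis a c) (star_basis b d))
                   (delta_s (basis t)) (delta_s (basis w)))"
proof (intro conjI allI)
  show "graded_hopf_basis (star_basis :: ntree \<Rightarrow> ntree \<Rightarrow> (ntree \<Rightarrow>\<^sub>0 'k))
      unit_tree delta_basis counit_basis ndeg"
    by (rule trees.graded_hopf_basis)
  show "star (star x y) z = star x (star y z)" for x y z :: "ntree \<Rightarrow>\<^sub>0 'k"
    unfolding star_def by (rule trees.m_assoc)
qed (simp add: star_def delta_s_def delta_star_basis)

end
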